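(* For the weight $2$ part $C^{\bullet}_{GF}(\mathfrak{ham}_4^0,Sp(4,\mathbb{R}))_2$ of the Gel'fand-Kalinin-Fuks cochain complex of $\mathfrak{ham}_4^0$ relative to $Sp(4,\mathbb{R})$, the Betti number (dimension of the cohomology group) is equal to $1$ in degree $2$ and is $0$ in every other degree.
   Context: On $\mathbb{R}^4$ with coordinates $x_1,x_2,x_3,x_4$ use the Poisson bracket $\{f,g\}=\frac{\partial f}{\partial x_1}\frac{\partial g}{\partial x_4}+\frac{\partial f}{\partial x_2}\frac{\partial g}{\partial x_3}-\frac{\partial f}{\partial x_3}\frac{\partial g}{\partial x_2}-\frac{\partial f}{\partial x_4}\frac{\partial g}{\partial x_1}$. Let $\mathfrak{ham}_4^0$ be the Lie algebra of Hamiltonian vector fields with polynomial potentials vanishing at the origin, identified with the Lie algebra, under $\{\cdot,\cdot\}$, of real polynomials all of whose homogeneous components have degree $\ge 2$. Let $\mathfrak{S}_\ell$ be the dual space of the space of homogeneous polynomials of degree $\ell$. Nonzero elements of $\mathfrak{S}_\ell$ have weight $\ell-2$, and nonzero elements of $\mathfrak{S}_{\ell_1}\wedge\cdots\wedge\mathfrak{S}_{\ell_s}$ have weight $\sum_i(\ell_i-2)$. The degree $m$, weight $w$ cochain space is $$C^m_{GF}(\mathfrak{ham}_4^0)_w=\bigoplus \Lambda^{k_2}\mathfrak{S}_2\wedge\Lambda^{k_3}\mathfrak{S}_3\wedge\cdots\wedge\Lambda^{k_s}\mathfrak{S}_s,$$ the sum being over all finite sequences of non-negative integers $(k_2,k_3,\dots)$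 with $\sum_i k_i=m$ and $\sum_i k_i(i-2)=w$. The coboundary operator $d$ is the (degree $+1$) antiderivation determined on $1$-cochains by $(d z)(f,g)=-\langle z,\{f,g\}\rangle$; it preserves weight. The relative cochain space $C^m_{GF}(\mathfrak{ham}_4^0,Sp(4,\mathbb{R}))_w$ consists of those $\sigma\in C^m_{GF}(\mathfrak{ham}_4^0)_w$ with $i_{\hat J(\xi)}\sigma=0$ and $i_{\hat J(\xi)}d\sigma=0$ for all $\xi\in\mathfrak{sp}(4,\mathbb{R})$, where $J$ is the momentum mapping of the linear action of $Sp(4,\mathbb{R})$ on $\mathbb{R}^4$, so that $\hat J(\xi)$ ranges over all homogeneous quadratic polynomials, and $i$ denotes interior product. (Equivalently, it is the space of $Sp(4,\mathbb{R})$-invariant cochains in which $\mathfrak{S}_2$ does not appear.) These form a complex under $d$ for each fixed $w$; the Betti number in degree $m$ is the dimension of its degree $m$ cohomology. *)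

theory Defs
  imports
    "HOL-Library.Function_Algebras"
    "HOL-Library.Numeral_Type"
    "HOL-Analysis.Finite_Function_Topology"
    "Jordan_Normal_Form.Determinant"
begin

section \<open>Polynomials on four-dimensional space and the Poisson bracket\<close>

text \<open>A polynomial in $x_1,\dots,x_4$ is a finitely supported function from exponent
  vectors to coefficients. The four variables are indexed by the four elements of the
  numeral type \<open>4\<close>, whose elements are \<open>1\<close>, \<open>2\<close>, \<open>3\<close> and \<open>4\<close> (which equals \<open>0\<close>
  in that type).\<close>

type_synonym poly4 = "(4 \<Rightarrow>\<^sub>0 nat) \<Rightarrow>\<^sub>0 real"

definition total_degree :: "(4 \<Rightarrow>\<^sub>0 nat) \<Rightarrow> nat" where
  "total_degree a = (\<Sum>i\<in>UNIV. Poly_Mapping.lookup a i)"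

text \<open>If $x_i$ does not occur in a monomial, the truncated exponent is harmless, since
  the coefficient is then zero.\<close>

definition partial :: "4 \<Rightarrow> poly4 \<Rightarrow> poly4" where
  "partial i p =
    (\<Sum>a\<in>Poly_Mapping.keys p.
       Poly_Mapping.single (a - Poly_Mapping.single i 1)
         (real (Poly_Mapping.lookup a i) * Poly_Mapping.lookup p a))"

definition poisson :: "poly4 \<Rightarrow> poly4 \<Rightarrow> poly4" where
  "poisson f g =
     partial 1 f * partial 4 g + partial 2 f * partial 3 g
   - partial 3 f * partial 2 g - partial 4 f * partial 1 g"

definition homogeneous :: "nat \<Rightarrow> poly4 set" where
  "homogeneous l = {p. \<forall>a\<in>Poly_Mapping.keys p. total_degree a = l}"

definition ham :: "poly4 set" where
  "ham = {p. \<forall>a\<in>Poly_Mapping.keys p. total_degree a \<ge> 2}"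

section \<open>Cochains\<close>

instantiation "fun" :: (type, real_vector) real_vector
begin

definition scaleR_fun :: "real \<Rightarrow> ('a \<Rightarrow> 'b) \<Rightarrow> 'a \<Rightarrow> 'b" where
  "scaleR_fun c f = (\<lambda>x. c *\<^sub>R f x)"

instance
  by standard (auto simp: scaleR_fun_def fun_eq_iff scaleR_add_right scaleR_add_left)

end

text \<open>A cochain of degree $m$ is an alternating form on \<^term>\<open>ham\<close>, encoded as a function on
  lists of polynomials which is zero on every list that does not consist of exactly $m$
  elements of \<^term>\<open>ham\<close>.\<close>

type_synonym cochain = "poly4 list \<Rightarrow> real"

text \<open>The dual space of the homogeneous polynomials of degree $l$; a functional on these is
  extended by zero to the homogeneous polynomials of all other degrees.\<close>

definition dual_homogeneous :: "nat \<Rightarrow> (poly4 \<Rightarrow> real) set" where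
  "dual_homogeneous l = {z. linear z \<and> (\<forall>k. k \<noteq> l \<longrightarrow> (\<forall>p\<in>homogeneous k. z p = 0))}"

text \<open>$(z_1\wedge\dots\wedge z_m)(f_1,\dots,f_m)=\det (z_i(f_j))$.\<close>

definition wedge :: "(poly4 \<Rightarrow> real) list \<Rightarrow> cochain" where
  "wedge zs fs =
    (if length fs = length zs \<and> set fs \<subseteq> ham
     then Determinant.det (mat (length zs) (length zs) (\<lambda>(i, j). (zs ! i) (fs ! j)))
     else 0)"

text \<open>$\Lambda^{k_2}\mathfrak{S}_2\wedge\Lambda^{k_3}\mathfrak{S}_3\wedge\cdots$, where
  \<open>ls\<close> is the list of degrees $2,\dots,2,3,\dots,3,\dots$ with $k_l$ entries $l$.\<close>

definition wedge_summand :: "(nat \<Rightarrow> nat) \<Rightarrow> cochain set" where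
  "wedge_summand k =
    span {wedge zs | zs ls. sorted ls \<and> (\<forall>l. count_list ls l = k l) \<and>
                            list_all2 (\<lambda>z l. z \<in> dual_homogeneous l) zs ls}"

text \<open>The sum of the subspaces \<^term>\<open>wedge_summand k\<close> is direct as they are spaces of forms of
  different multidegrees.\<close>

definition cochains :: "nat \<Rightarrow> nat \<Rightarrow> cochain set" where
  "cochains m w =
    span (\<Union>k\<in>{k. k 0 = 0 \<and> k 1 = 0 \<and> finite {l. k l \<noteq> 0} \<and>
                   (\<Sum>l | k l \<noteq> 0. k l) = m \<and>
                   (\<Sum>l | k l \<noteq> 0. k l * (l - 2)) = w}. wedge_summand k)"

section \<open>Coboundary operator and interior product\<close>

definition remove_nth :: "nat \<Rightarrow> 'a list \<Rightarrow> 'a list" where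
  "remove_nth i xs = take i xs @ drop (Suc i) xs"

text \<open>The antiderivation determined by $(dz)(f,g)=-\langle z,\{f,g\}\rangle$ is, on
  alternating forms, the Chevalley-Eilenberg operator
  $(d\sigma)(f_0,\dots,f_m)=\sum_{i<j}(-1)^{i+j}
   \sigma(\{f_i,f_j\},f_0,\dots,\widehat{f_i},\dots,\widehat{f_j},\dots,f_m)$;
  see \<open>coboundary_one\<close> and \<open>coboundary_wedge\<close> below.\<close>

definition coboundary :: "cochain \<Rightarrow> cochain" where
  "coboundary \<sigma> fs =
    (if set fs \<subseteq> ham
     then \<Sum>j<length fs. \<Sum>i<j.
            (- 1) ^ (i + j) * \<sigma> (poisson (fs ! i) (fs ! j) # remove_nth i (remove_nth j fs))
     else 0)"

definition interior_product :: "poly4 \<Rightarrow> cochain \<Rightarrow> cochain" where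
  "interior_product f \<sigma> = (\<lambda>fs. \<sigma> (f # fs))"

lemma keys_partial_subset:
  "b \<in> Poly_Mapping.keys (partial i p) \<Longrightarrow>
    \<exists>a\<in>Poly_Mapping.keys p. total_degree a = Suc (total_degree b)"
proof -
  assume "b \<in> Poly_Mapping.keys (partial i p)"
  then have "Poly_Mapping.lookup (partial i p) b \<noteq> 0" by (simp add: in_keys_iff)
  then have "(\<Sum>a\<in>Poly_Mapping.keys p. Poly_Mapping.lookup
        (Poly_Mapping.single (a - Poly_Mapping.single i 1)
        (real (Poly_Mapping.lookup a i) * Poly_Mapping.lookup p a)) b) \<noteq> 0"
    by (simp add: partial_def lookup_sum)
  then obtain a where a: "a \<in> Poly_Mapping.keys p"
    and nz: "Poly_Mapping.lookup (Poly_Mapping.single (a - Poly_Mapping.single i 1)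
        (real (Poly_Mapping.lookup a i) * Poly_Mapping.lookup p a)) b \<noteq> 0"
    by (meson sum.not_neutral_contains_not_neutral)
  have b: "b = a - Poly_Mapping.single i 1" and ai: "Poly_Mapping.lookup a i \<noteq> 0"
    using nz by (auto simp: lookup_single when_def split: if_splits)
  have "total_degree a = Poly_Mapping.lookup a i + (\<Sum>j\<in>UNIV - {i}. Poly_Mapping.lookup a j)"
    unfolding total_degree_def by (simp add: sum.remove)
  moreover have "total_degree b = Poly_Mapping.lookup b i + (\<Sum>j\<in>UNIV - {i}. Poly_Mapping.lookup b j)"
    unfolding total_degree_def by (simp add: sum.remove)
  moreover have "(\<Sum>j\<in>UNIV - {i}. Poly_Mapping.lookup b j) = (\<Sum>j\<in>UNIV - {i}. Poly_Mapping.lookup a j)"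
    by (rule sum.cong) (auto simp: b lookup_minus lookup_single)
  moreover have "Poly_Mapping.lookup b i = Poly_Mapping.lookup a i - 1" by (simp add: b lookup_minus)
  ultimately show ?thesis using a ai by (intro bexI[of _ a]) auto
qed

lemma keys_partial_times:
  assumes "f \<in> ham" "g \<in> ham" "c \<in> Poly_Mapping.keys (partial i f * partial j g)"
  shows "2 \<le> total_degree c"
proof -
  from assms(3) obtain a b
    where ab: "a \<in> Poly_Mapping.keys (partial i f)" "b \<in> Poly_Mapping.keys (partial j g)"
    and c: "c = a + b"
    using keys_mult[of "partial i f" "partial j g"] by blast
  have "1 \<le> total_degree a" "1 \<le> total_degree b"
    using keys_partial_subset[OF ab(1)] keys_partial_subset[OF ab(2)] assms(1,2)
    by (fastforce simp: ham_def)+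
  moreover have "total_degree c = total_degree a + total_degree b"
    by (simp add: total_degree_def c lookup_add sum.distrib)
  ultimately show ?thesis by simp
qed

lemma poisson_in_ham:
  assumes "f \<in> ham" "g \<in> ham"
  shows "poisson f g \<in> ham"
proof -
  have "total_degree c \<ge> 2" if "c \<in> Poly_Mapping.keys (poisson f g)" for c
  proof -
    have "c \<in> Poly_Mapping.keys (partial 1 f * partial 4 g) \<union> Poly_Mapping.keys (partial 2 f * partial 3 g)
        \<union> Poly_Mapping.keys (partial 3 f * partial 2 g) \<union> Poly_Mapping.keys (partial 4 f * partial 1 g)"
      using that by (auto simp: poisson_def in_keys_iff lookup_add lookup_minus)
    then show ?thesis using keys_partial_times[OF assms] by blast
  qed
  then show ?thesis by (simp add: ham_def)
qed

lemma length_remove_nth: "i < length xs \<Longrightarrow> length (remove_nth i xs) = length xs - 1"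
  by (simp add: remove_nth_def)

lemma nth_remove_nth:
  "i < length xs \<Longrightarrow> k < length xs - 1 \<Longrightarrow>
    remove_nth i xs ! k = xs ! (if k < i then k else Suc k)"
  by (auto simp: remove_nth_def nth_append min_def)

lemma set_remove_nth_subset: "set (remove_nth i xs) \<subseteq> set xs"
  using set_take_subset[of i xs] set_drop_subset[of "Suc i" xs]
  by (auto simp: remove_nth_def)

lemma set_remove_nth2:
  assumes "i < j" "j < length xs"
  shows "set xs = {xs ! i, xs ! j} \<union> set (remove_nth i (remove_nth j xs))"
proof -
  have *: "set ys = {ys ! k} \<union> set (remove_nth k ys)" if "k < length ys" for k and ys :: "'a list"
    using that by (subst id_take_nth_drop[OF that]) (auto simp: remove_nth_def nth_append)
  have "set xs = {xs ! j} \<union> set (remove_nth j xs)" using * assms by blast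
  also have "set (remove_nth j xs) =
      {remove_nth j xs ! i} \<union> set (remove_nth i (remove_nth j xs))"
    by (rule *) (use assms in \<open>simp add: length_remove_nth\<close>)
  also have "remove_nth j xs ! i = xs ! i" using assms by (simp add: nth_remove_nth)
  finally show ?thesis by auto
qed

lemma coboundary_one:
  assumes "f \<in> ham" "g \<in> ham"
  shows "coboundary (wedge [z]) [f, g] = - z (poisson f g)"
  using assms poisson_in_ham[OF assms]
  by (simp add: coboundary_def wedge_def remove_nth_def det_single lessThan_Suc
      numeral_2_eq_2)

text \<open>The exterior product of a 2-form with another form.\<close>

definition two_form_wedge :: "cochain \<Rightarrow> cochain \<Rightarrow> cochain" where
  "two_form_wedge \<omega> \<beta> fs =
    (\<Sum>j<length fs. \<Sum>i<j.
       (- 1) ^ (i + j + 1) * \<omega> [fs ! i, fs ! j] * \<beta> (remove_nth i (remove_nth j fs)))"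

text \<open>$d(z_0\wedge\dots\wedge z_n)=\sum_a (-1)^a\,
   dz_a\wedge z_0\wedge\dots\wedge\widehat{z_a}\wedge\dots\wedge z_n$; the 2-form $dz_a$ has been
  moved to the front without a change of sign.\<close>

lemma coboundary_wedge:
  "coboundary (wedge zs) =
    (\<Sum>a<length zs. (- 1) ^ a *\<^sub>R
       two_form_wedge (coboundary (wedge [zs ! a])) (wedge (remove_nth a zs)))"
proof
  fix fs :: "poly4 list"
  let ?m = "length zs"
  let ?r = "\<lambda>i j. remove_nth i (remove_nth j fs)"
  have app: "(\<Sum>a<?m. (- 1) ^ a *\<^sub>R
       two_form_wedge (coboundary (wedge [zs ! a])) (wedge (remove_nth a zs))) fs
     = (\<Sum>a<?m. (- 1) ^ a *
         two_form_wedge (coboundary (wedge [zs ! a])) (wedge (remove_nth a zs)) fs)"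
  proof -
    have "sum g A fs = (\<Sum>a\<in>A. g a fs)" for g :: "nat \<Rightarrow> cochain" and A
      by (induction A rule: infinite_finite_induct) auto
    then show ?thesis by (simp add: scaleR_fun_def)
  qed
  have term_eq: "(if set fs \<subseteq> ham
        then (- 1) ^ (i + j) * wedge zs (poisson (fs ! i) (fs ! j) # ?r i j) else 0) =
      (\<Sum>a<?m. (- 1) ^ a * ((- 1) ^ (i + j + 1) * coboundary (wedge [zs ! a]) [fs ! i, fs ! j]
          * wedge (remove_nth a zs) (?r i j)))"
    (is "?L = ?R") if ij: "i < j" "j < length fs" for i j
  proof (cases "set fs \<subseteq> ham \<and> length fs = Suc ?m")
    case False
    have "?R = 0"
    proof (rule sum.neutral, rule ballI)
      fix a assume a: "a \<in> {..<?m}"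
      have len: "length (?r i j) = length fs - 2" "length (remove_nth a zs) = ?m - 1"
        using ij a by (auto simp: length_remove_nth)
      show "(- 1) ^ a * ((- 1) ^ (i + j + 1) * coboundary (wedge [zs ! a]) [fs ! i, fs ! j]
          * wedge (remove_nth a zs) (?r i j)) = 0"
      proof (cases "set fs \<subseteq> ham")
        case True
        then have "length fs \<noteq> Suc ?m" using False by blast
        then have "wedge (remove_nth a zs) (?r i j) = 0"
          using ij a by (auto simp: wedge_def len)
        then show ?thesis by simp
      next
        case False
        then have "\<not> {fs ! i, fs ! j} \<subseteq> ham \<or> \<not> set (?r i j) \<subseteq> ham"
          using set_remove_nth2[OF ij] by blast
        then show ?thesis by (auto simp: coboundary_def wedge_def)
      qed
    qed
    moreover have "?L = 0" using False ij by (auto simp: wedge_def length_remove_nth)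
    ultimately show ?thesis by simp
  next
    case True
    let ?g = "poisson (fs ! i) (fs ! j) # ?r i j"
    let ?M = "mat ?m ?m (\<lambda>(a, b). (zs ! a) (?g ! b))"
    have H: "fs ! i \<in> ham" "fs ! j \<in> ham" using True ij by auto
    have rH: "set (?r i j) \<subseteq> ham"
      using True set_remove_nth2[OF ij] by blast
    have gH: "set ?g \<subseteq> ham" using rH poisson_in_ham[OF H] by simp
    have m: "0 < ?m" using ij True by linarith
    have lr: "length (?r i j) = ?m - 1" using ij True by (simp add: length_remove_nth)
    have "wedge zs ?g = det ?M" using gH lr m by (simp add: wedge_def)
    also have "\<dots> = (\<Sum>a<?m. ?M $$ (a, 0) * cofactor ?M a 0)"
      by (rule laplace_expansion_column[OF _ m]) simp
    also have "\<dots> = (\<Sum>a<?m. (zs ! a) (poisson (fs ! i) (fs ! j)) *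
        ((- 1) ^ a * wedge (remove_nth a zs) (?r i j)))"
    proof (rule sum.cong[OF refl])
      fix a assume "a \<in> {..<?m}"
      then have a: "a < ?m" by simp
      have "mat_delete ?M a 0 =
          mat (?m - 1) (?m - 1) (\<lambda>(k, l). (remove_nth a zs ! k) (?r i j ! l))"
        using a by (intro eq_matI) (auto simp: mat_delete_def nth_remove_nth)
      then have "cofactor ?M a 0 = (- 1) ^ a * wedge (remove_nth a zs) (?r i j)"
        using a rH lr by (simp add: cofactor_def wedge_def length_remove_nth)
      then show "?M $$ (a, 0) * cofactor ?M a 0 = (zs ! a) (poisson (fs ! i) (fs ! j)) *
        ((- 1) ^ a * wedge (remove_nth a zs) (?r i j))"
        using a m by simp
    qed
    finally have "?L = (- 1) ^ (i + j) * (\<Sum>a<?m. (zs ! a) (poisson (fs ! i) (fs ! j)) *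
        ((- 1) ^ a * wedge (remove_nth a zs) (?r i j)))"
      using True by simp
    also have "\<dots> = ?R"
      unfolding sum_distrib_left
      by (rule sum.cong[OF refl]) (simp add: coboundary_one[OF H])
    finally show ?thesis .
  qed
  have "coboundary (wedge zs) fs = (\<Sum>j<length fs. \<Sum>i<j.
      if set fs \<subseteq> ham
      then (- 1) ^ (i + j) * wedge zs (poisson (fs ! i) (fs ! j) # ?r i j) else 0)"
    by (simp add: coboundary_def)
  also have "\<dots> = (\<Sum>j<length fs. \<Sum>i<j. \<Sum>a<?m. (- 1) ^ a * ((- 1) ^ (i + j + 1) *
      coboundary (wedge [zs ! a]) [fs ! i, fs ! j] * wedge (remove_nth a zs) (?r i j)))"
    by (intro sum.cong refl) (use term_eq in auto)
  also have "\<dots> = (\<Sum>j<length fs. \<Sum>a<?m. \<Sum>i<j. (- 1) ^ a * ((- 1) ^ (i + j + 1) *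
      coboundary (wedge [zs ! a]) [fs ! i, fs ! j] * wedge (remove_nth a zs) (?r i j)))"
    by (intro sum.cong[OF refl] sum.swap)
  also have "\<dots> = (\<Sum>a<?m. \<Sum>j<length fs. \<Sum>i<j. (- 1) ^ a * ((- 1) ^ (i + j + 1) *
      coboundary (wedge [zs ! a]) [fs ! i, fs ! j] * wedge (remove_nth a zs) (?r i j)))"
    by (rule sum.swap)
  also have "\<dots> = (\<Sum>a<?m. (- 1) ^ a *
         two_form_wedge (coboundary (wedge [zs ! a])) (wedge (remove_nth a zs)) fs)"
    by (simp only: two_form_wedge_def sum_distrib_left)
  finally show "coboundary (wedge zs) fs = (\<Sum>a<?m. (- 1) ^ a *\<^sub>R
       two_form_wedge (coboundary (wedge [zs ! a])) (wedge (remove_nth a zs))) fs"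
    by (simp only: app)
qed

section \<open>Relative cochains and Betti numbers\<close>

text \<open>For $\xi\in\mathfrak{sp}(4,\mathbb{R})$ the Hamiltonians $\hat J(\xi)$ are exactly the
  homogeneous quadratic polynomials.\<close>

definition relative_cochains :: "nat \<Rightarrow> nat \<Rightarrow> cochain set" where
  "relative_cochains m w =
    {\<sigma> \<in> cochains m w. \<forall>q\<in>homogeneous 2.
       interior_product q \<sigma> = 0 \<and> interior_product q (coboundary \<sigma>) = 0}"

definition relative_cocycles :: "nat \<Rightarrow> nat \<Rightarrow> cochain set" where
  "relative_cocycles m w = {\<sigma> \<in> relative_cochains m w. coboundary \<sigma> = 0}"

definition relative_coboundaries :: "nat \<Rightarrow> nat \<Rightarrow> cochain set" where
  "relative_coboundaries m w =
    (if m = 0 then {0} else coboundary ` relative_cochains (m - 1) w)"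

text \<open>The quotient space $Z/B$ has dimension $n$: the classes modulo $B$ of some $n$ elements
  of $Z$ form a basis of $Z/B$.\<close>

definition coset :: "'a::real_vector set \<Rightarrow> 'a \<Rightarrow> 'a set" where
  "coset B x = (+) x ` B"

definition has_quotient_dim :: "'a::real_vector set \<Rightarrow> 'a set \<Rightarrow> nat \<Rightarrow> bool" where
  "has_quotient_dim Z B n \<longleftrightarrow>
    (\<exists>X. X \<subseteq> Z \<and> finite X \<and> card X = n \<and>
      (\<forall>c. coset B (\<Sum>x\<in>X. c x *\<^sub>R x) = coset B 0 \<longrightarrow> (\<forall>x\<in>X. c x = 0)) \<and>
      (\<forall>z\<in>Z. \<exists>c. coset B z = coset B (\<Sum>x\<in>X. c x *\<^sub>R x)))"

definition has_betti_number :: "nat \<Rightarrow> nat \<Rightarrow> nat \<Rightarrow> bool" where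
  "has_betti_number m w n \<longleftrightarrow>
    has_quotient_dim (relative_cocycles m w) (relative_coboundaries m w) n"

end

theory Submission
  imports "HOL-Analysis.Cartesian_Space" Defs
begin

text \<open>In weight 2, a product of functionals that has no factor from \<open>\<SS>\<^sub>2\<close> is a functional on quartic
  polynomials (degree 1) or a 2-form on cubic polynomials (degree 2). Relative cochains vanish on
  quadratic arguments and hence do not change when the quadratic parts of their arguments are
  removed (\<open>relative_cochain_drop_quadratic\<close>); after that, all products with a factor from \<open>\<SS>\<^sub>2\<close>
  vanish. So there are no nonzero relative cochains outside degrees 1 and 2. In these two degrees,
  the condition on the coboundary says that the cochain is invariant under the quadratic
  polynomials, which act by the bracket.

  In degree 1 there is no invariant functional except 0: every quartic is a sum of brackets
  \<open>{q, p}\<close> of quadratic and quartic polynomials, by an explicit Casimir-type identity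
  (\<open>Var_times_eq_sum_poisson\<close>), and an invariant functional vanishes on such brackets.

  In degree 2 the invariant forms on cubics are a line. Uniqueness (\<open>invariant_form_eq_0\<close>) is the
  usual highest weight argument: a form that vanishes on the pair \<open>x\<^sub>1\<^sup>3, x\<^sub>4\<^sup>3\<close> has \<open>x\<^sub>4\<^sup>3\<close> in its
  radical, and \<open>x\<^sub>4\<^sup>3\<close> generates all cubics. For existence, the form is the third transvectant: the
  bidifferential operator of the bracket applied three times and evaluated at 0. For it,
  multiplication by a variable is adjoint to the bracket with this variable, which gives the
  invariance (\<open>transvectant_invariant\<close>). It is closed, because invariance settles the case of a
  quadratic argument, and brackets of polynomials of order at least 3 have order at least 4
  (\<open>transvectant_cocycle\<close>).

  As the relative complex is concentrated in degree 2, where it is one-dimensional, so is its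
  cohomology.\<close>

section \<open>Polynomials and their derivatives\<close>

lemma lookup_scaleR_poly_mapping [simp]:
  "Poly_Mapping.lookup (c *\<^sub>R p) a = c *\<^sub>R Poly_Mapping.lookup p a"
proof -
  have "finite {a. c *\<^sub>R Poly_Mapping.lookup p a \<noteq> 0}"
    by (rule finite_subset[OF _ finite_lookup[of p]]) auto
  then show ?thesis by (simp add: scaleR_poly_mapping_def)
qed

lemma scaleR_single: "c *\<^sub>R Poly_Mapping.single a (x::real) = Poly_Mapping.single a (c * x)"
  by (rule poly_mapping_eqI) (simp add: lookup_single when_def)

lemma poly_eq_sum_single:
  "p = (\<Sum>a\<in>Poly_Mapping.keys p. Poly_Mapping.single a (Poly_Mapping.lookup p a))"
  for p :: "'a \<Rightarrow>\<^sub>0 real"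
proof (rule poly_mapping_eqI)
  fix b
  show "Poly_Mapping.lookup p b = Poly_Mapping.lookup
      (\<Sum>a\<in>Poly_Mapping.keys p. Poly_Mapping.single a (Poly_Mapping.lookup p a)) b"
    by (simp add: lookup_sum lookup_single when_def in_keys_iff)
qed

lemma scaleR_eq_single_times: "c *\<^sub>R p = Poly_Mapping.single 0 c * p" for p :: poly4
proof -
  have "c *\<^sub>R p = (\<Sum>a\<in>Poly_Mapping.keys p. Poly_Mapping.single 0 c * Poly_Mapping.single a (Poly_Mapping.lookup p a))"
    by (subst poly_eq_sum_single[of p]) (simp add: scaleR_sum_right scaleR_single mult_single)
  then show ?thesis
    by (simp only: sum_distrib_left[symmetric] poly_eq_sum_single[of p, symmetric])
qed

lemma scaleR_times_left: "(c *\<^sub>R p) * q = c *\<^sub>R (p * q)" for p q :: poly4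
  by (simp add: scaleR_eq_single_times mult.assoc)

lemma scaleR_times_right: "p * (c *\<^sub>R q) = c *\<^sub>R (p * q)" for p q :: poly4
  by (simp add: scaleR_eq_single_times mult.left_commute)

lemma numeral_times_poly: "numeral k * p = (numeral k :: real) *\<^sub>R p" for p :: poly4
  by (simp add: scaleR_eq_single_times)

lemma total_degree_add: "total_degree (a + b) = total_degree a + total_degree b"
  by (simp add: total_degree_def lookup_add sum.distrib)

lemma total_degree_single [simp]: "total_degree (Poly_Mapping.single i n) = n"
  by (simp add: total_degree_def lookup_single when_def)

lemma lookup_partial:
  "Poly_Mapping.lookup (partial i p) b =
    real (Suc (Poly_Mapping.lookup b i)) * Poly_Mapping.lookup p (b + Poly_Mapping.single i 1)"
proof -
  let ?e = "Poly_Mapping.single i (1::nat)"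
  have *: "Poly_Mapping.lookup (Poly_Mapping.single (a - ?e)
        (real (Poly_Mapping.lookup a i) * Poly_Mapping.lookup p a)) b =
      (if a = b + ?e then real (Suc (Poly_Mapping.lookup b i)) * Poly_Mapping.lookup p (b + ?e) else 0)"
    for a
  proof (cases "Poly_Mapping.lookup a i = 0")
    case True
    then have "a \<noteq> b + ?e" by (auto simp: lookup_add)
    then show ?thesis using True by simp
  next
    case False
    then have "a - ?e + ?e = a"
      by (intro poly_mapping_eqI) (auto simp: lookup_add lookup_minus lookup_single when_def)
    then have "a - ?e = b \<longleftrightarrow> a = b + ?e" by (metis add_diff_cancel_right')
    then show ?thesis
      by (auto simp: lookup_single when_def lookup_add)
  qed
  show ?thesis
    by (simp add: partial_def lookup_sum * in_keys_iff del: One_nat_def)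
qed

lemma linear_partial: "linear (partial i)"
  by (rule linearI) (auto intro!: poly_mapping_eqI simp: lookup_partial lookup_add algebra_simps)

lemmas partial_add = linear_add[OF linear_partial]
  and partial_neg = linear_neg[OF linear_partial]
  and partial_scaleR = linear_scale[OF linear_partial]
  and partial_0 [simp] = linear_0[OF linear_partial]

lemma partial_commute: "partial i (partial j p) = partial j (partial i p)"
  by (rule poly_mapping_eqI) (auto simp: lookup_partial lookup_add lookup_single when_def add_ac)

lemma partial_single:
  "partial i (Poly_Mapping.single a c) =
    Poly_Mapping.single (a - Poly_Mapping.single i 1) (real (Poly_Mapping.lookup a i) * c)"
  by (cases "c = 0") (simp_all add: partial_def)

definition Var :: "4 \<Rightarrow> poly4" where
  "Var i = Poly_Mapping.single (Poly_Mapping.single i 1) 1"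

text \<open>Linear identities between polynomials are checked on monomials; the monomials of \<open>p\<close>
  suffice, so that the identity may be one that holds in a single degree only.\<close>

lemma linear_eqI_single:
  assumes "linear (F :: poly4 \<Rightarrow> 'b::real_vector)" "linear G"
    "\<And>a. a \<in> Poly_Mapping.keys p \<Longrightarrow> F (Poly_Mapping.single a 1) = G (Poly_Mapping.single a 1)"
  shows "F p = G p"
proof -
  have p: "p = (\<Sum>a\<in>Poly_Mapping.keys p. Poly_Mapping.lookup p a *\<^sub>R Poly_Mapping.single a 1)"
    by (simp add: scaleR_single flip: poly_eq_sum_single)
  have "F p = (\<Sum>a\<in>Poly_Mapping.keys p. Poly_Mapping.lookup p a *\<^sub>R F (Poly_Mapping.single a 1))"
    by (subst p) (simp add: linear_sum[OF assms(1)] linear_scale[OF assms(1)])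
  also have "\<dots> = (\<Sum>a\<in>Poly_Mapping.keys p. Poly_Mapping.lookup p a *\<^sub>R G (Poly_Mapping.single a 1))"
    by (simp add: assms(3))
  also have "\<dots> = G p"
    by (subst (2) p) (simp add: linear_sum[OF assms(2)] linear_scale[OF assms(2)])
  finally show ?thesis .
qed

lemma linear_times: "linear (\<lambda>p. q * p)" for q :: poly4
  by (rule linearI) (auto simp: distrib_left scaleR_times_right)

lemma partial_Var_times:
  "partial i (Var u * f) = (if i = u then f else 0) + Var u * partial i f"
proof (rule linear_eqI_single[of "\<lambda>f. partial i (Var u * f)"
      "\<lambda>f. (if i = u then f else 0) + Var u * partial i f" f])
  show "linear (\<lambda>f. partial i (Var u * f))"
    using linear_compose[OF linear_times linear_partial] by (simp add: o_def)
  show "linear (\<lambda>f. (if i = u then f else 0) + Var u * partial i f)"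
    by (rule linearI) (auto simp: partial_add partial_scaleR distrib_left scaleR_times_right scaleR_add_right)
  fix a
  let ?e = "\<lambda>i. Poly_Mapping.single i (1::nat)"
  have "?e i + a - ?e i = a" by simp
  moreover have "?e i + (a - ?e i) = a" if "Poly_Mapping.lookup a i \<noteq> 0"
    using that by (intro poly_mapping_eqI) (auto simp: lookup_add lookup_minus lookup_single when_def)
  moreover have "?e u + a - ?e i = ?e u + (a - ?e i)" if "i \<noteq> u"
    using that by (intro poly_mapping_eqI) (auto simp: lookup_add lookup_minus lookup_single when_def)
  ultimately show "partial i (Var u * Poly_Mapping.single a 1) =
      (if i = u then Poly_Mapping.single a 1 else 0) + Var u * partial i (Poly_Mapping.single a 1)"
    by (cases "Poly_Mapping.lookup a i = 0")
      (auto simp: Var_def mult_single partial_single lookup_add lookup_single single_add[symmetric] add_ac)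
qed

lemma partial_1 [simp]: "partial i 1 = 0"
  by (simp add: partial_single flip: single_one)

lemma partial_Var: "partial i (Var u) = (if i = u then 1 else 0)"
  using partial_Var_times[of i u 1] by simp

lemma homogeneous_iff:
  "p \<in> homogeneous n \<longleftrightarrow> (\<forall>a. total_degree a \<noteq> n \<longrightarrow> Poly_Mapping.lookup p a = 0)"
  by (auto simp: homogeneous_def in_keys_iff)

lemma subspace_homogeneous: "subspace (homogeneous n)"
  by (rule subspaceI) (auto simp: homogeneous_iff lookup_add)

lemma homogeneous_times:
  assumes "p \<in> homogeneous m" "q \<in> homogeneous n"
  shows "p * q \<in> homogeneous (m + n)"
  using assms keys_mult[of p q] by (fastforce simp: homogeneous_def total_degree_add)

lemma Var_homogeneous: "Var i \<in> homogeneous 1"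
  by (simp add: Var_def homogeneous_def)

lemma Var_times_homogeneous:
  "Var i * Var j \<in> homogeneous 2" "Var i * (Var j * Var k) \<in> homogeneous 3"
proof -
  show *: "Var i * Var j \<in> homogeneous 2" for i j
    using homogeneous_times[OF Var_homogeneous Var_homogeneous, of i j] by (simp add: numeral_2_eq_2)
  show "Var i * (Var j * Var k) \<in> homogeneous 3"
    using homogeneous_times[OF Var_homogeneous *] by (simp add: numeral_3_eq_3 numeral_2_eq_2)
qed

lemma partial_homogeneous:
  assumes "p \<in> homogeneous (Suc n)" shows "partial i p \<in> homogeneous n"
  using assms by (auto simp: homogeneous_iff lookup_partial total_degree_add)

lemma partial_homogeneous_0:
  assumes "p \<in> homogeneous 0" shows "partial i p = 0"
  using assms by (auto intro!: poly_mapping_eqI simp: homogeneous_iff lookup_partial total_degree_add)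

text \<open>Euler's relation for homogeneous polynomials: both sides multiply a monomial by its total
  degree.\<close>

lemma euler:
  assumes "p \<in> homogeneous n"
  shows "Var 1 * partial 1 p + Var 2 * partial 2 p + Var 3 * partial 3 p + Var 4 * partial 4 p = real n *\<^sub>R p"
proof (rule linear_eqI_single[of "\<lambda>p. Var 1 * partial 1 p + Var 2 * partial 2 p + Var 3 * partial 3 p + Var 4 * partial 4 p"
      "\<lambda>p. real n *\<^sub>R p" p])
  have 1: "linear (\<lambda>p. Var i * partial i p)" for i
    using linear_compose[OF linear_partial linear_times] by (simp add: o_def)
  show "linear (\<lambda>p. Var 1 * partial 1 p + Var 2 * partial 2 p + Var 3 * partial 3 p + Var 4 * partial 4 p)"
    by (intro linear_compose_add 1)
  show "linear (\<lambda>p. real n *\<^sub>R p :: poly4)" by (simp add: linear_scale_self)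
  fix a assume "a \<in> Poly_Mapping.keys p"
  then have a: "total_degree a = n" using assms by (simp add: homogeneous_def)
  have 2: "Var i * partial i (Poly_Mapping.single a 1) = Poly_Mapping.single a (real (Poly_Mapping.lookup a i))" for i
  proof (cases "Poly_Mapping.lookup a i = 0")
    case False
    then have "Poly_Mapping.single i 1 + (a - Poly_Mapping.single i 1) = a"
      by (intro poly_mapping_eqI) (auto simp: lookup_add lookup_minus lookup_single when_def)
    then show ?thesis by (simp add: Var_def partial_single mult_single)
  qed (simp add: partial_single)
  show "Var 1 * partial 1 (Poly_Mapping.single a 1) + Var 2 * partial 2 (Poly_Mapping.single a 1) +
      Var 3 * partial 3 (Poly_Mapping.single a 1) + Var 4 * partial 4 (Poly_Mapping.single a 1)
     = real n *\<^sub>R Poly_Mapping.single a 1"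
    unfolding 2 using a by (auto simp: scaleR_single total_degree_def sum_4 simp flip: single_add)
qed

text \<open>A homogeneous polynomial of positive degree is a sum of multiples of monomials, each of which
  contains some variable. So a linear property need only be checked on products with a variable.\<close>

lemma homogeneous_Suc_induct [consumes 1, case_names subspace Var]:
  assumes "p \<in> homogeneous (Suc n)"
    and S: "subspace {p. P p}"
    and V: "\<And>i q. q \<in> homogeneous n \<Longrightarrow> P (Var i * q)"
  shows "P p"
proof -
  have *: "P (Poly_Mapping.single a 1)" if a: "a \<in> Poly_Mapping.keys p" for a
  proof -
    have t: "total_degree a = Suc n" using a assms(1) by (auto simp: homogeneous_def)
    then obtain i where "Poly_Mapping.lookup a i \<noteq> 0" unfolding total_degree_def
      by (metis sum.neutral Zero_not_Suc)
    then have e: "Poly_Mapping.single i 1 + (a - Poly_Mapping.single i 1) = a"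
      by (intro poly_mapping_eqI) (auto simp: lookup_add lookup_minus lookup_single when_def)
    have "total_degree (a - Poly_Mapping.single i 1) = n"
      using t total_degree_add[of "Poly_Mapping.single i 1" "a - Poly_Mapping.single i 1", unfolded e]
      by simp
    then have "P (Var i * Poly_Mapping.single (a - Poly_Mapping.single i 1) 1)"
      by (intro V) (simp add: homogeneous_def)
    then show ?thesis by (simp add: Var_def mult_single e del: One_nat_def)
  qed
  have "(\<Sum>a\<in>Poly_Mapping.keys p. Poly_Mapping.lookup p a *\<^sub>R Poly_Mapping.single a 1) \<in> {p. P p}"
    by (intro subspace_sum[OF S] subspace_mul[OF S]) (simp add: *)
  then show ?thesis by (simp add: scaleR_single flip: poly_eq_sum_single)
qed

lemma homogeneous_0: "p \<in> homogeneous 0 \<Longrightarrow> p = Poly_Mapping.lookup p 0 *\<^sub>R 1"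
proof (rule poly_mapping_eqI)
  fix a :: "4 \<Rightarrow>\<^sub>0 nat"
  assume p: "p \<in> homogeneous 0"
  show "Poly_Mapping.lookup p a = Poly_Mapping.lookup (Poly_Mapping.lookup p 0 *\<^sub>R 1) a"
  proof (cases "total_degree a = 0")
    case True
    then have "a = 0" by (intro poly_mapping_eqI) (simp add: total_degree_def)
    then show ?thesis by simp
  next
    case False
    then have "a \<noteq> 0" by (auto simp: total_degree_def)
    then show ?thesis using p False by (simp add: homogeneous_iff lookup_one)
  qed
qed

section \<open>The Poisson bracket and the action of the quadratic polynomials\<close>

lemma bilinear_poisson: "bilinear poisson"
  unfolding bilinear_def poisson_def
  by (auto intro!: linearI simp: partial_add partial_scaleR scaleR_times_left scaleR_times_right
      algebra_simps)

lemma poisson_anticommute: "poisson f g = - poisson g f"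
  by (simp add: poisson_def algebra_simps)

text \<open>By the choice of the bracket, the variables \<open>x\<^sub>1, x\<^sub>4\<close> and \<open>x\<^sub>2, x\<^sub>3\<close> are conjugate pairs:
  bracketing with a variable is, up to sign, the derivative in the conjugate direction.\<close>

lemma poisson_Var:
  "poisson (Var 1) f = partial 4 f" "poisson (Var 2) f = partial 3 f"
  "poisson (Var 3) f = - partial 2 f" "poisson (Var 4) f = - partial 1 f"
  by (simp_all add: poisson_def partial_Var)

lemma poisson_Var_times_left:
  "poisson (Var u * f) h = Var u * poisson f h + f * poisson (Var u) h"
  using exhaust_4[of u]
  by (auto simp: poisson_def partial_Var_times partial_Var) (simp_all add: algebra_simps)

lemma poisson_Var_times_right:
  "poisson h (Var u * f) = poisson h (Var u) * f + Var u * poisson h f"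
  using exhaust_4[of u]
  by (auto simp: poisson_def partial_Var_times partial_Var) (simp_all add: algebra_simps)

lemma poisson_homogeneous:
  assumes "f \<in> homogeneous (Suc m)" "g \<in> homogeneous (Suc n)"
  shows "poisson f g \<in> homogeneous (m + n)"
  unfolding poisson_def
  by (intro subspace_diff subspace_add subspace_homogeneous homogeneous_times
      partial_homogeneous assms)

lemma poisson_order:
  assumes "\<And>a. a \<in> Poly_Mapping.keys f \<Longrightarrow> 3 \<le> total_degree a"
    and "\<And>a. a \<in> Poly_Mapping.keys g \<Longrightarrow> 3 \<le> total_degree a"
    and c: "total_degree c = 3"
  shows "Poly_Mapping.lookup (poisson f g) c = 0"
proof -
  have "c \<notin> Poly_Mapping.keys (partial i f * partial j g)" for i j
  proof
    assume "c \<in> Poly_Mapping.keys (partial i f * partial j g)"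
    then obtain a b where ab: "a \<in> Poly_Mapping.keys (partial i f)" "b \<in> Poly_Mapping.keys (partial j g)"
      and "c = a + b"
      using keys_mult[of "partial i f" "partial j g"] by blast
    moreover have "2 \<le> total_degree a" "2 \<le> total_degree b"
      using keys_partial_subset[OF ab(1)] keys_partial_subset[OF ab(2)] assms(1,2) by fastforce+
    ultimately show False using c by (simp add: total_degree_add)
  qed
  then show ?thesis by (simp add: poisson_def lookup_add lookup_minus in_keys_iff)
qed

lemma quadratic_induct [consumes 1, case_names subspace monomial]:
  assumes "q \<in> homogeneous 2" and S: "subspace {p. P p}" and V: "\<And>i j. P (Var i * Var j)"
  shows "P q"
proof -
  have "P (Var i * r)" if "r \<in> homogeneous 1" for i r
  proof -
    have S': "subspace {r. P (Var i * r)}"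
      using linear_subspace_vimage[OF linear_times S, of "Var i"] by (simp add: vimage_def)
    have "P (Var i * (Var j * s))" if "s \<in> homogeneous 0" for j s
    proof -
      have "Var i * (Var j * s) = Poly_Mapping.lookup s 0 *\<^sub>R (Var i * Var j)"
        by (subst homogeneous_0[OF that]) (simp add: scaleR_times_right)
      then show ?thesis using subspace_mul[OF S, of "Var i * Var j"] V by simp
    qed
    then show ?thesis using homogeneous_Suc_induct[of r 0 "\<lambda>r. P (Var i * r)"] S' that by simp
  qed
  then show ?thesis
    using homogeneous_Suc_induct[of q 1 P] S assms(1) by (simp add: numeral_2_eq_2)
qed

lemma cubic_induct [consumes 1, case_names subspace monomial]:
  assumes "f \<in> homogeneous 3" and S: "subspace {p. P p}"
    and V: "\<And>i j k. P (Var i * (Var j * Var k))"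
  shows "P f"
proof -
  have "P (Var i * r)" if "r \<in> homogeneous 2" for i r
  proof -
    have S': "subspace {r. P (Var i * r)}"
      using linear_subspace_vimage[OF linear_times S, of "Var i"] by (simp add: vimage_def)
    show ?thesis using quadratic_induct[of r "\<lambda>r. P (Var i * r)"] S' V that by simp
  qed
  then show ?thesis
    using homogeneous_Suc_induct[of f 2 P] S assms(1) by (simp add: numeral_3_eq_3 numeral_2_eq_2)
qed

text \<open>The sum on the left is a Casimir-type contraction of \<open>{x\<^sub>i x\<^sub>j, x\<^sub>k r}\<close> over conjugate pairs
  \<open>j, k\<close>. By the Leibniz rule it consists of \<open>4\<close> copies of \<open>x\<^sub>i r\<close> from the brackets
  \<open>{x\<^sub>j, x\<^sub>k}\<close>, one more from the brackets \<open>{x\<^sub>i, x\<^sub>k}\<close>, and \<open>n\<close> from Euler's relation, while the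
  terms with \<open>{x\<^sub>i, r}\<close> cancel. Hence every homogeneous polynomial of positive degree is a sum of
  brackets of a quadratic polynomial with one of the same degree.\<close>

lemma Var_times_eq_sum_poisson:
  assumes "r \<in> homogeneous n"
  shows "poisson (Var i * Var 1) (Var 4 * r) + poisson (Var i * Var 2) (Var 3 * r)
     - poisson (Var i * Var 3) (Var 2 * r) - poisson (Var i * Var 4) (Var 1 * r)
     = real (n + 5) *\<^sub>R (Var i * r)"
proof -
  let ?E = "Var 1 * partial 1 r + Var 2 * partial 2 r + Var 3 * partial 3 r + Var 4 * partial 4 r"
  have "poisson (Var i * Var 1) (Var 4 * r) + poisson (Var i * Var 2) (Var 3 * r)
     - poisson (Var i * Var 3) (Var 2 * r) - poisson (Var i * Var 4) (Var 1 * r)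
     = Var i * ?E + 5 * (Var i * r)"
    using exhaust_4[of i]
    by (auto simp: poisson_Var_times_left poisson_Var_times_right poisson_Var partial_Var)
      (simp_all add: algebra_simps)
  also have "\<dots> = real n *\<^sub>R (Var i * r) + 5 *\<^sub>R (Var i * r)"
    unfolding euler[OF assms] by (simp add: scaleR_times_right scaleR_eq_single_times[of 5])
  finally show ?thesis by (simp add: scaleR_add_left)
qed

text \<open>An invariant functional vanishes on brackets with quadratic polynomials, and these exhaust the
  polynomials of a positive degree by the preceding identity.\<close>

lemma invariant_functional_eq_0:
  assumes "linear z" "p \<in> homogeneous (Suc n)"
    and z: "\<And>q p. q \<in> homogeneous 2 \<Longrightarrow> p \<in> homogeneous (Suc n) \<Longrightarrow> z (poisson q p) = (0::real)"
  shows "z p = 0"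
  using assms(2)
proof (induction rule: homogeneous_Suc_induct)
  case subspace
  then show ?case by (rule linear_subspace_kernel[OF assms(1)])
next
  case (Var i r)
  have W: "Var j * r \<in> homogeneous (Suc n)" for j
    using homogeneous_times[OF Var_homogeneous Var] by simp
  have "real (n + 5) * z (Var i * r) = z (real (n + 5) *\<^sub>R (Var i * r))"
    by (simp only: linear_scale[OF assms(1)] real_scaleR_def)
  also have "\<dots> = 0"
    unfolding Var_times_eq_sum_poisson[OF Var, symmetric]
    by (simp add: linear_add[OF assms(1)] linear_diff[OF assms(1)] z Var_times_homogeneous W)
  finally show ?case by (simp add: add_nonneg_eq_0_iff)
qed

section \<open>Transvectants\<close>

text \<open>The \<open>n\<close>-th transvectant iterates the bidifferential operator of the Poisson bracket \<open>n\<close> times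
  and evaluates the result at the origin. On homogeneous polynomials of degree \<open>n\<close> it is the
  invariant bilinear form.\<close>

fun transvectant :: "nat \<Rightarrow> poly4 \<Rightarrow> poly4 \<Rightarrow> real" where
  "transvectant 0 f g = Poly_Mapping.lookup f 0 * Poly_Mapping.lookup g 0"
| "transvectant (Suc n) f g =
     transvectant n (partial 1 f) (partial 4 g) + transvectant n (partial 2 f) (partial 3 g)
   - transvectant n (partial 3 f) (partial 2 g) - transvectant n (partial 4 f) (partial 1 g)"

lemma bilinear_transvectant: "bilinear (transvectant n)"
proof -
  have "transvectant n (f + f') g = transvectant n f g + transvectant n f' g" for f f' g
    by (induction n arbitrary: f f' g) (simp_all add: lookup_add partial_add algebra_simps)
  moreover have "transvectant n f (g + g') = transvectant n f g + transvectant n f g'" for f g g'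
    by (induction n arbitrary: f g g') (simp_all add: lookup_add partial_add algebra_simps)
  moreover have "transvectant n (c *\<^sub>R f) g = c * transvectant n f g" for c f g
    by (induction n arbitrary: f g) (simp_all add: partial_scaleR algebra_simps)
  moreover have "transvectant n f (c *\<^sub>R g) = c * transvectant n f g" for c f g
    by (induction n arbitrary: f g) (simp_all add: partial_scaleR algebra_simps)
  ultimately show ?thesis by (auto simp: bilinear_def intro!: linearI)
qed

lemmas transvectant_add_left = bilinear_ladd[OF bilinear_transvectant]
  and transvectant_add_right = bilinear_radd[OF bilinear_transvectant]
  and transvectant_diff_left = bilinear_lsub[OF bilinear_transvectant]
  and transvectant_neg_left = bilinear_lneg[OF bilinear_transvectant]
  and transvectant_neg_right = bilinear_rneg[OF bilinear_transvectant]
  and transvectant_0_left [simp] = bilinear_lzero[OF bilinear_transvectant]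
  and transvectant_0_right [simp] = bilinear_rzero[OF bilinear_transvectant]

text \<open>Each of the \<open>n\<close> contractions with the Poisson tensor contributes one sign.\<close>

lemma transvectant_commute: "transvectant n g f = (- 1) ^ n * transvectant n f g"
proof (induction n arbitrary: f g)
  case (Suc n)
  show ?case
    by (simp add: Suc.IH[of "partial 1 g" "partial 4 f"] Suc.IH[of "partial 2 g" "partial 3 f"]
        Suc.IH[of "partial 3 g" "partial 2 f"] Suc.IH[of "partial 4 g" "partial 1 f"] algebra_simps)
qed simp

lemma lookup_Var_times_0: "Poly_Mapping.lookup (Var u * f) 0 = 0"
proof -
  have "0 \<notin> Poly_Mapping.keys (Var u * f)"
  proof
    assume "0 \<in> Poly_Mapping.keys (Var u * f)"
    then obtain b where "0 = Poly_Mapping.single u (1::nat) + b"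
      using keys_mult[of "Var u" f] by (auto simp: Var_def)
    then have "total_degree 0 = total_degree (Poly_Mapping.single u (1::nat) + b)" by simp
    then show False by (simp add: total_degree_add) (simp add: total_degree_def)
  qed
  then show ?thesis by (simp add: in_keys_iff)
qed

text \<open>Multiplication by a variable is, up to the factor \<open>n\<close>, adjoint to the bracket with that
  variable. All invariance properties of the transvectants come from this.\<close>

lemma transvectant_Var_times_left:
  "transvectant n (Var u * f) g = real n * transvectant (n - 1) f (poisson (Var u) g)"
proof (induction n arbitrary: f g)
  case 0
  then show ?case by (simp add: lookup_Var_times_0)
next
  case (Suc n)
  have "transvectant (Suc n) (Var u * f) g = transvectant n f (poisson (Var u) g) +
     (transvectant n (Var u * partial 1 f) (partial 4 g) + transvectant n (Var u * partial 2 f) (partial 3 g)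
   - transvectant n (Var u * partial 3 f) (partial 2 g) - transvectant n (Var u * partial 4 f) (partial 1 g))"
    using exhaust_4[of u]
    by (auto simp: partial_Var_times transvectant_add_left transvectant_neg_right poisson_Var)
  also have "\<dots> = real (Suc n) * transvectant n f (poisson (Var u) g)"
  proof (cases n)
    case 0
    then show ?thesis by (simp add: lookup_Var_times_0)
  next
    case (Suc k)
    have C: "poisson (Var u) (partial i g) = partial i (poisson (Var u) g)" for i
      using exhaust_4[of u] by (auto simp: poisson_Var partial_neg partial_commute)
    show ?thesis
      unfolding Suc.IH C by (simp add: Suc algebra_simps)
  qed
  finally show ?case by simp
qed

text \<open>For \<open>q = x\<^sub>i x\<^sub>j\<close> the Leibniz rule and adjointness turn the first summand into
  \<open>n (\<langle>{x\<^sub>j,f},{x\<^sub>i,g}\<rangle> + \<langle>{x\<^sub>i,f},{x\<^sub>j,g}\<rangle>)\<close> for the transvectant of order \<open>n - 1\<close>. This is symmetric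
  in \<open>f\<close> and \<open>g\<close> as \<open>n - 1\<close> is even, whereas the transvectant of order \<open>n\<close> is antisymmetric; so the
  two summands cancel.\<close>

lemma transvectant_invariant:
  assumes "q \<in> homogeneous 2" "odd n"
  shows "transvectant n (poisson q f) g + transvectant n f (poisson q g) = 0"
  using assms(1)
proof (induction rule: quadratic_induct)
  case subspace
  show ?case
    by (intro linear_subspace_kernel linearI)
      (simp_all add: bilinear_ladd[OF bilinear_poisson] bilinear_lmul[OF bilinear_poisson]
        bilinear_lmul[OF bilinear_transvectant] bilinear_rmul[OF bilinear_transvectant]
        transvectant_add_left transvectant_add_right algebra_simps)
next
  case (monomial i j)
  have *: "transvectant n (poisson (Var i * Var j) f) g =
      real n * (transvectant (n - 1) (poisson (Var j) f) (poisson (Var i) g) +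
                transvectant (n - 1) (poisson (Var i) f) (poisson (Var j) g))" for f g
    by (simp add: poisson_Var_times_left transvectant_add_left transvectant_Var_times_left algebra_simps)
  have "even (n - 1)" using assms(2) by simp
  then have sym: "transvectant (n - 1) a b = transvectant (n - 1) b a" for a b
    using transvectant_commute[of "n - 1" a b] by simp
  have "transvectant n f (poisson (Var i * Var j) g) = - transvectant n (poisson (Var i * Var j) g) f"
    using transvectant_commute[of n f "poisson (Var i * Var j) g"] assms(2) by simp
  then show ?case unfolding *
    using sym[of "poisson (Var j) f" "poisson (Var i) g"] sym[of "poisson (Var i) f" "poisson (Var j) g"]
    by (simp add: algebra_simps)
qed

text \<open>The \<open>n\<close> derivatives, evaluated at the origin, see only the part of degree \<open>n\<close>.\<close>

lemma transvectant_eq_0: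
  assumes "\<And>a. total_degree a = n \<Longrightarrow> Poly_Mapping.lookup f a = 0"
  shows "transvectant n f g = 0"
  using assms
proof (induction n arbitrary: f g)
  case 0
  then show ?case by (simp add: total_degree_def)
next
  case (Suc n)
  have "transvectant n (partial i f) h = 0" for i h
    by (rule Suc.IH) (simp add: lookup_partial Suc.prems total_degree_add)
  then show ?case by simp
qed

lemma transvectant_quadratic:
  assumes "q \<in> homogeneous 2"
  shows "transvectant 3 q g = 0" "transvectant 3 g q = 0"
proof -
  show "transvectant 3 q g = 0" for g
    by (rule transvectant_eq_0) (use assms in \<open>simp add: homogeneous_iff\<close>)
  then show "transvectant 3 g q = 0" using transvectant_commute[of 3 g q] by simp
qed

lemma transvectant_highest: "transvectant 3 (Var 1 * (Var 1 * Var 1)) (Var 4 * (Var 4 * Var 4)) \<noteq> 0"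
  by (simp add: numeral_3_eq_3 partial_Var_times partial_Var lookup_add partial_add
      numeral_times_poly partial_scaleR)

section \<open>Uniqueness of the invariant form on cubics\<close>

lemma poisson_Var_1_Var: "poisson (Var 1) (Var i) = (if i = 4 then 1 else 0)"
  by (simp add: poisson_Var partial_Var)

lemma poisson_Var_Var_4: "poisson (Var i) (Var 4) = (if i = 1 then 1 else 0)"
  using exhaust_4[of i] by (auto simp: poisson_Var partial_Var)

lemma poisson_Var_Var: "\<exists>c. poisson (Var i) (Var j) = c *\<^sub>R 1"
  using exhaust_4[of i]
  by (auto simp: poisson_Var partial_Var intro: exI[of _ 0])
    (metis scaleR_one scaleR_minus1_left)+

text \<open>The cubics are generated by the extremal weight vector \<open>x\<^sub>4\<^sup>3\<close>. Bracketing with \<open>x\<^sub>1 y\<close>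
  replaces a factor \<open>x\<^sub>4\<close> by \<open>y\<close>, up to terms that have already been reached; this is done three
  times.\<close>

lemma cubics_in_invariant_subspace:
  assumes S: "subspace K"
    and closed: "\<And>q g. q \<in> homogeneous 2 \<Longrightarrow> g \<in> homogeneous 3 \<Longrightarrow> g \<in> K \<Longrightarrow> poisson q g \<in> K"
    and top: "Var 4 * (Var 4 * Var 4) \<in> K"
    and "g \<in> homogeneous 3"
  shows "g \<in> K"
proof -
  have num: "p \<in> K" if "numeral k * p \<in> K" for k p
    using subspace_mul[OF S that, of "1 / numeral k"] by (simp add: numeral_times_poly)
  have cl: "poisson (Var a * Var b) (Var i * (Var j * Var k)) \<in> K" if "Var i * (Var j * Var k) \<in> K"
    for a b i j k using closed that Var_times_homogeneous by blast
  note rules = poisson_Var_times_left poisson_Var_times_right poisson_Var_1_Var poisson_Var_Var_4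
  have 1: "Var i * (Var 4 * Var 4) \<in> K" for i
  proof -
    have "poisson (Var 1 * Var i) (Var 4 * (Var 4 * Var 4)) =
       (if i = 1 then 6 else 3) * (Var i * (Var 4 * Var 4))" if "i \<noteq> 4"
      using that by (simp add: rules; simp add: algebra_simps)
    then have "(if i = 1 then 6 else 3) * (Var i * (Var 4 * Var 4)) \<in> K" if "i \<noteq> 4"
      using cl[OF top, of 1 i] that by simp
    then show ?thesis using top num by (cases "i = 4"; cases "i = 1") auto
  qed
  have 2: "Var i * (Var j * Var 4) \<in> K" for i j
  proof -
    have 11: "Var 1 * (Var i * Var 4) \<in> K" for i
    proof (cases "i = 4")
      case False
      then have "poisson (Var 1 * Var 1) (Var i * (Var 4 * Var 4)) = 4 * (Var 1 * (Var i * Var 4))"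
        by (simp add: rules; simp add: algebra_simps)
      then show ?thesis using cl[OF 1, of 1 1 i] num by metis
    qed (use 1 in simp)
    consider "i = 1" | "j = 1" | "i = 4" | "j = 4" | "i \<noteq> 1" "j \<noteq> 1" "i \<noteq> 4" "j \<noteq> 4" by blast
    then show ?thesis
    proof cases
      case 1
      then show ?thesis using 11 by simp
    next
      case 2
      then show ?thesis using 11[of i] by (simp add: mult.left_commute)
    next
      case 3
      then show ?thesis using 1[of j] by (simp add: mult.left_commute)
    next
      case 4
      then show ?thesis using 1[of i] by simp
    next
      case 5
      obtain c where c: "poisson (Var j) (Var i) = c *\<^sub>R 1" using poisson_Var_Var by blast
      have "poisson (Var 1 * Var j) (Var i * (Var 4 * Var 4)) - c *\<^sub>R (Var 1 * (Var 4 * Var 4))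
          = 2 * (Var i * (Var j * Var 4))"
        using 5 by (simp add: rules c scaleR_times_left scaleR_times_right; simp add: algebra_simps)
      moreover have "poisson (Var 1 * Var j) (Var i * (Var 4 * Var 4)) - c *\<^sub>R (Var 1 * (Var 4 * Var 4)) \<in> K"
        by (intro subspace_diff[OF S] subspace_mul[OF S] cl 1)
      ultimately show ?thesis using num by metis
    qed
  qed
  \<comment> \<open>For \<open>k = 1\<close> the bracket is taken with \<open>x\<^sub>1\<^sup>2\<close>, by the Leibniz rule \<open>2 x\<^sub>1 {x\<^sub>1, _}\<close>; hence the factor 2.\<close>
  have 3: "Var i * (Var j * Var k) \<in> K" for i j k
  proof -
    have 24: "Var i * (Var 4 * Var j) \<in> K" "Var 4 * (Var i * Var j) \<in> K" for i j
      using 2[of i j] by (simp_all add: ac_simps)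
    consider "i = 4" | "j = 4" | "k = 4" | "i \<noteq> 4" "j \<noteq> 4" "k \<noteq> 4" by blast
    then show ?thesis
    proof cases
      case 4
      obtain c d where c: "poisson (Var k) (Var i) = c *\<^sub>R 1" and d: "poisson (Var k) (Var j) = d *\<^sub>R 1"
        using poisson_Var_Var by blast
      have "poisson (Var 1 * Var k) (Var i * (Var j * Var 4)) - c *\<^sub>R (Var 1 * (Var j * Var 4))
          - d *\<^sub>R (Var 1 * (Var i * Var 4)) = (if k = 1 then 2 else 1) * (Var i * (Var j * Var k))"
        using 4 by (simp add: rules c d scaleR_times_left scaleR_times_right;
            simp add: algebra_simps; simp add: scaleR_times_right mult.left_commute)
      moreover have "poisson (Var 1 * Var k) (Var i * (Var j * Var 4)) - c *\<^sub>R (Var 1 * (Var j * Var 4))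
          - d *\<^sub>R (Var 1 * (Var i * Var 4)) \<in> K"
        by (intro subspace_diff[OF S] subspace_mul[OF S] cl 2)
      ultimately show ?thesis using num[of "num.Bit0 num.One"] by (simp split: if_splits)
    qed (use 2 24 in auto)
  qed
  show ?thesis
    using cubic_induct[of g "\<lambda>g. g \<in> K"] S 3 assms(4) by simp
qed

text \<open>Uniqueness of the invariant form. The polynomial \<open>x\<^sub>1 x\<^sub>4\<close> acts diagonally on monomials, and
  invariance under it makes monomials orthogonal unless their weights are opposite. Only \<open>x\<^sub>1\<^sup>3\<close> has
  the weight opposite to that of \<open>x\<^sub>4\<^sup>3\<close>, so \<open>x\<^sub>4\<^sup>3\<close> lies in the radical. The radical is an invariant
  subspace, hence contains all cubics.\<close>

lemma invariant_form_eq_0: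
  assumes B: "bilinear (B :: poly4 \<Rightarrow> poly4 \<Rightarrow> real)"
    and inv: "\<And>q f g. q \<in> homogeneous 2 \<Longrightarrow> f \<in> homogeneous 3 \<Longrightarrow> g \<in> homogeneous 3 \<Longrightarrow>
      B (poisson q f) g + B f (poisson q g) = 0"
    and zero: "B (Var 1 * (Var 1 * Var 1)) (Var 4 * (Var 4 * Var 4)) = 0"
    and "f \<in> homogeneous 3" "g \<in> homogeneous 3"
  shows "B f g = 0"
proof -
  have lr: "linear (B x)" "linear (\<lambda>x. B x y)" for x y using B by (auto simp: bilinear_def)
  define K where "K = {g. \<forall>f\<in>homogeneous 3. B f g = 0}"
  have "subspace K"
    unfolding K_def
    by (rule subspaceI) (simp_all add: linear_0[OF lr(1)] linear_add[OF lr(1)] linear_scale[OF lr(1)])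
  moreover have "poisson q g \<in> K" if q: "q \<in> homogeneous 2" and g: "g \<in> homogeneous 3" "g \<in> K" for q g
  proof -
    have "poisson q f \<in> homogeneous 3" if "f \<in> homogeneous 3" for f
      using poisson_homogeneous[of q 1 f 2] q that by (simp add: numeral_2_eq_2 numeral_3_eq_3)
    then show ?thesis using inv[OF q] g by (fastforce simp: K_def)
  qed
  moreover have "Var 4 * (Var 4 * Var 4) \<in> K"
  proof -
    \<comment> \<open>\<open>?w i\<close> is the weight of \<open>x\<^sub>i\<close>, its eigenvalue under the bracket with \<open>x\<^sub>1 x\<^sub>4\<close>.\<close>
    let ?w = "\<lambda>i::4. if i = 4 then 1 else if i = 1 then - 1 else (0::real)"
    let ?H = "Var 1 * Var 4"
    have w: "poisson ?H (Var i) = ?w i *\<^sub>R Var i" for i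
      using exhaust_4[of i] by (auto simp: poisson_Var_times_left poisson_Var partial_Var)
    have w3: "poisson ?H (Var i * (Var j * Var k)) = (?w i + ?w j + ?w k) *\<^sub>R (Var i * (Var j * Var k))" for i j k
      unfolding poisson_Var_times_right[of ?H] w by (simp add: scaleR_times_left scaleR_times_right algebra_simps)
    have "B (Var i * (Var j * Var k)) (Var 4 * (Var 4 * Var 4)) = 0" for i j k
    proof -
      have "(?w i + ?w j + ?w k + 3) * B (Var i * (Var j * Var k)) (Var 4 * (Var 4 * Var 4)) = 0"
        using inv[of ?H "Var i * (Var j * Var k)" "Var 4 * (Var 4 * Var 4)"]
        unfolding w3 linear_scale[OF lr(1)] linear_scale[OF lr(2)] real_scaleR_def
        by (simp add: Var_times_homogeneous algebra_simps)
      then show ?thesis using zero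
        by (cases "i = 1 \<and> j = 1 \<and> k = 1") (auto split: if_splits)
    qed
    then show ?thesis unfolding K_def
      using cubic_induct[of _ "\<lambda>f. B f (Var 4 * (Var 4 * Var 4)) = 0"] linear_subspace_kernel[OF lr(2)]
      by blast
  qed
  ultimately have "g \<in> K" using cubics_in_invariant_subspace assms(5) by blast
  then show ?thesis using assms(4) by (simp add: K_def)
qed

section \<open>Cochains as alternating forms\<close>

lemma subspace_ham: "subspace ham"
proof -
  have *: "ham = {p. \<forall>a. total_degree a < 2 \<longrightarrow> Poly_Mapping.lookup p a = 0}"
    by (auto simp: ham_def in_keys_iff) (metis in_keys_iff not_le)+
  show ?thesis unfolding * by (rule subspaceI) (simp_all add: lookup_add)
qed

lemma homogeneous_in_ham: "p \<in> homogeneous l \<Longrightarrow> 2 \<le> l \<Longrightarrow> p \<in> ham"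
  by (auto simp: homogeneous_def ham_def)

definition component :: "nat \<Rightarrow> poly4 \<Rightarrow> poly4" where
  "component l p =
    (\<Sum>a | a \<in> Poly_Mapping.keys p \<and> total_degree a = l. Poly_Mapping.single a (Poly_Mapping.lookup p a))"

lemma lookup_component:
  "Poly_Mapping.lookup (component l p) a = (if total_degree a = l then Poly_Mapping.lookup p a else 0)"
  by (simp add: component_def lookup_sum lookup_single when_def in_keys_iff)

lemma linear_component: "linear (component l)"
  by (rule linearI) (auto intro!: poly_mapping_eqI simp: lookup_component lookup_add)

lemma component_homogeneous: "component l p \<in> homogeneous l"
  by (simp add: homogeneous_iff lookup_component)

lemma component_of_homogeneous:
  "p \<in> homogeneous k \<Longrightarrow> component l p = (if k = l then p else 0)"
  by (auto intro!: poly_mapping_eqI simp: homogeneous_iff lookup_component)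

lemma dual_homogeneous_component:
  assumes "z \<in> dual_homogeneous l"
  shows "z p = z (component l p)"
proof -
  have z: "linear z" using assms by (simp add: dual_homogeneous_def)
  show ?thesis
  proof (rule linear_eqI_single[of z "\<lambda>p. z (component l p)" p])
    show "linear (\<lambda>p. z (component l p))"
      using linear_compose[OF linear_component z] by (simp add: o_def)
    fix a
    have "Poly_Mapping.single a 1 \<in> homogeneous (total_degree a)" by (simp add: homogeneous_def)
    then show "z (Poly_Mapping.single a 1) = z (component l (Poly_Mapping.single a 1))"
      using assms linear_0[OF z]
      by (auto simp: component_of_homogeneous dual_homogeneous_def)
  qed (fact z)
qed

lemma dual_homogeneous_of_component:
  assumes "z \<in> dual_homogeneous l"
  shows "z (component k p) = (if k = l then z p else 0)"
  using assms component_homogeneous[of k p] dual_homogeneous_component[OF assms, of p]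
  by (auto simp: dual_homogeneous_def)

definition drop_quadratic :: "poly4 \<Rightarrow> poly4" where
  "drop_quadratic p = p - component 2 p"

lemma component_drop_quadratic:
  "component l (drop_quadratic p) = (if l = 2 then 0 else component l p)"
  by (auto intro!: poly_mapping_eqI simp: drop_quadratic_def lookup_component lookup_minus)

lemma drop_quadratic_in_ham: "p \<in> ham \<Longrightarrow> drop_quadratic p \<in> ham"
  unfolding drop_quadratic_def
  by (intro subspace_diff subspace_ham homogeneous_in_ham[OF component_homogeneous]) auto

lemma drop_quadratic_add: "drop_quadratic p + component 2 p = p"
  by (simp add: drop_quadratic_def)

lemma dual_homogeneous_drop_quadratic:
  assumes "z \<in> dual_homogeneous l"
  shows "z (drop_quadratic p) = (if l = 2 then 0 else z p)"
proof -
  have "z 0 = 0" using assms by (simp add: dual_homogeneous_def linear_0)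
  then show ?thesis
    using dual_homogeneous_component[OF assms, of "drop_quadratic p"]
      dual_homogeneous_component[OF assms, of p]
    by (simp add: component_drop_quadratic)
qed

lemma drop_quadratic_order:
  assumes "f \<in> ham" "a \<in> Poly_Mapping.keys (drop_quadratic f)"
  shows "3 \<le> total_degree a"
proof -
  have "total_degree a \<noteq> 2" "Poly_Mapping.lookup f a \<noteq> 0"
    using assms(2) by (auto simp: in_keys_iff drop_quadratic_def lookup_minus lookup_component split: if_splits)
  moreover have "2 \<le> total_degree a" if "a \<in> Poly_Mapping.keys f" using assms(1) that by (simp add: ham_def)
  ultimately show ?thesis by (simp add: in_keys_iff)
qed

text \<open>Antisymmetry is recorded as the sign rule for moving an argument to the front; this makes
  linearity in the first argument enough.\<close>

definition alternating_form :: "nat \<Rightarrow> cochain \<Rightarrow> bool" where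
  "alternating_form m \<sigma> \<longleftrightarrow>
     (\<forall>fs. \<not> (length fs = m \<and> set fs \<subseteq> ham) \<longrightarrow> \<sigma> fs = 0) \<and>
     (\<forall>fs. \<forall>p\<in>ham. \<forall>q\<in>ham. \<sigma> ((p + q) # fs) = \<sigma> (p # fs) + \<sigma> (q # fs)) \<and>
     (\<forall>fs c. \<forall>p\<in>ham. \<sigma> ((c *\<^sub>R p) # fs) = c * \<sigma> (p # fs)) \<and>
     (\<forall>xs ys p. \<sigma> (xs @ p # ys) = (- 1) ^ length xs * \<sigma> (p # xs @ ys))"

lemma alternating_form_zero:
  "alternating_form m \<sigma> \<Longrightarrow> \<not> (length fs = m \<and> set fs \<subseteq> ham) \<Longrightarrow> \<sigma> fs = 0"
  unfolding alternating_form_def by blast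

lemma alternating_form_front:
  "alternating_form m \<sigma> \<Longrightarrow> \<sigma> (xs @ p # ys) = (- 1) ^ length xs * \<sigma> (p # xs @ ys)"
  unfolding alternating_form_def by blast

lemma alternating_form_add:
  assumes "alternating_form m \<sigma>" "p \<in> ham" "q \<in> ham"
  shows "\<sigma> (xs @ (p + q) # ys) = \<sigma> (xs @ p # ys) + \<sigma> (xs @ q # ys)"
proof -
  have "\<sigma> ((p + q) # xs @ ys) = \<sigma> (p # xs @ ys) + \<sigma> (q # xs @ ys)"
    using assms unfolding alternating_form_def by blast
  then show ?thesis by (simp only: alternating_form_front[OF assms(1)] distrib_left)
qed

lemma alternating_form_scaleR:
  assumes "alternating_form m \<sigma>" "p \<in> ham"
  shows "\<sigma> (xs @ (c *\<^sub>R p) # ys) = c * \<sigma> (xs @ p # ys)"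
proof -
  have "\<sigma> ((c *\<^sub>R p) # xs @ ys) = c * \<sigma> (p # xs @ ys)"
    using assms unfolding alternating_form_def by blast
  then show ?thesis by (simp only: alternating_form_front[OF assms(1)] mult.left_commute)
qed

lemma subspace_alternating_form: "subspace {\<sigma>. alternating_form m \<sigma>}"
  by (rule subspaceI) (simp_all add: alternating_form_def scaleR_fun_def algebra_simps)

text \<open>Laplace expansion of the determinant along the column of the argument \<open>p\<close>.\<close>

lemma wedge_expand_argument:
  assumes "set (xs @ p # ys) \<subseteq> ham" "length zs = length (xs @ p # ys)"
  shows "wedge zs (xs @ p # ys) =
    (\<Sum>a<length zs. (zs ! a) p * ((- 1) ^ (a + length xs) * wedge (remove_nth a zs) (xs @ ys)))"
proof -
  let ?n = "length zs" and ?c = "length xs"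
  let ?M = "mat ?n ?n (\<lambda>(a, b). (zs ! a) ((xs @ p # ys) ! b))"
  have c: "?c < ?n" using assms by simp
  have "wedge zs (xs @ p # ys) = Determinant.det ?M" using assms by (simp add: wedge_def)
  also have "\<dots> = (\<Sum>a<?n. ?M $$ (a, ?c) * cofactor ?M a ?c)"
    by (rule laplace_expansion_column[OF _ c]) simp
  also have "\<dots> = (\<Sum>a<length zs. (zs ! a) p * ((- 1) ^ (a + length xs) * wedge (remove_nth a zs) (xs @ ys)))"
  proof (rule sum.cong[OF refl])
    fix a assume "a \<in> {..<?n}"
    then have a: "a < ?n" by simp
    have "mat_delete ?M a ?c =
        mat (?n - 1) (?n - 1) (\<lambda>(k, l). (remove_nth a zs ! k) ((xs @ ys) ! l))"
      using a assms(2) by (intro eq_matI) (auto simp: mat_delete_def nth_remove_nth nth_append)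
    then show "?M $$ (a, ?c) * cofactor ?M a ?c =
        (zs ! a) p * ((- 1) ^ (a + ?c) * wedge (remove_nth a zs) (xs @ ys))"
      using a c assms by (simp add: cofactor_def wedge_def length_remove_nth)
  qed
  finally show ?thesis .
qed

lemma alternating_form_wedge:
  assumes "\<forall>z\<in>set zs. linear z"
  shows "alternating_form (length zs) (wedge zs)"
  unfolding alternating_form_def
proof (intro conjI allI ballI impI)
  show "wedge zs fs = 0" if "\<not> (length fs = length zs \<and> set fs \<subseteq> ham)" for fs
    using that by (auto simp: wedge_def)
  show "wedge zs ((p + q) # fs) = wedge zs (p # fs) + wedge zs (q # fs)"
    if "p \<in> ham" "q \<in> ham" for fs p q
  proof (cases "set fs \<subseteq> ham \<and> length zs = length (p # fs)")
    case True
    have "p + q \<in> ham" using that subspace_add[OF subspace_ham] by blast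
    then show ?thesis using True that assms wedge_expand_argument[of "[]" _ fs zs]
      by (simp add: linear_add sum.distrib distrib_right)
  qed (auto simp: wedge_def)
  show "wedge zs ((c *\<^sub>R p) # fs) = c * wedge zs (p # fs)"
    if "p \<in> ham" for fs c p
  proof (cases "set fs \<subseteq> ham \<and> length zs = length (p # fs)")
    case True
    have "c *\<^sub>R p \<in> ham" using that subspace_mul[OF subspace_ham] by blast
    then show ?thesis using True that assms wedge_expand_argument[of "[]" _ fs zs]
      by (simp add: linear_scale sum_distrib_left distrib_left mult.assoc)
  qed (auto simp: wedge_def)
  show "wedge zs (xs @ p # ys) = (- 1) ^ length xs * wedge zs (p # xs @ ys)" for xs ys p
  proof (cases "set (xs @ p # ys) \<subseteq> ham \<and> length zs = length (xs @ p # ys)")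
    case True
    then show ?thesis
      using wedge_expand_argument[of "[]" p "xs @ ys" zs]
      by (simp add: wedge_expand_argument sum_distrib_left power_add ac_simps
          del: sum.lessThan_Suc)
  qed (auto simp: wedge_def)
qed

text \<open>The multiplicities in the definition of cochains are traded for the list of degrees of the
  factors, whose length and weight are prescribed.\<close>

lemma cochain_induct [consumes 1, case_names subspace wedge]:
  assumes "\<sigma> \<in> cochains m w"
    and S: "subspace {\<sigma>. P \<sigma>}"
    and W: "\<And>zs ls. length ls = m \<Longrightarrow> (\<forall>l\<in>set ls. 2 \<le> l) \<Longrightarrow> (\<Sum>l\<leftarrow>ls. l - 2) = w \<Longrightarrow>
      list_all2 (\<lambda>z l. z \<in> dual_homogeneous l) zs ls \<Longrightarrow> P (wedge zs)"
  shows "P \<sigma>"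
proof -
  have "wedge_summand k \<subseteq> {\<sigma>. P \<sigma>}"
    if k: "k 0 = 0" "k 1 = 0" "(\<Sum>l | k l \<noteq> 0. k l) = m" "(\<Sum>l | k l \<noteq> 0. k l * (l - 2)) = w" for k
    unfolding wedge_summand_def
  proof (rule span_minimal[OF _ S], safe)
    fix zs ls
    assume c: "\<forall>l. count_list ls l = k l" and zs: "list_all2 (\<lambda>z l. z \<in> dual_homogeneous l) zs ls"
    have set: "{l. k l \<noteq> 0} = set ls" by (auto simp: count_list_0_iff c[rule_format, symmetric])
    show "P (wedge zs)"
    proof (rule W)
      show "length ls = m" using k(3) unfolding set by (simp add: sum_count_set c[rule_format, symmetric])
      show "\<forall>l\<in>set ls. 2 \<le> l"
      proof
        fix l assume "l \<in> set ls"
        then have "k l \<noteq> 0" using set by blast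
        then have "l \<noteq> 0" "l \<noteq> 1" using k by metis+
        then show "2 \<le> l" by simp
      qed
      show "(\<Sum>l\<leftarrow>ls. l - 2) = w" using k(4) unfolding set
        by (simp add: sum_list_map_eq_sum_count c[rule_format, symmetric])
    qed (fact zs)
  qed
  then have "cochains m w \<subseteq> {\<sigma>. P \<sigma>}"
    unfolding cochains_def by (intro span_minimal[OF _ S]) blast
  then show ?thesis using assms(1) by blast
qed

lemma cochains_alternating_form: "\<sigma> \<in> cochains m w \<Longrightarrow> alternating_form m \<sigma>"
proof (induction rule: cochain_induct)
  case subspace
  show ?case by (rule subspace_alternating_form)
next
  case (wedge zs ls)
  have "linear z" if "z \<in> set zs" for z
    using that wedge(4) by (auto simp: list_all2_conv_all_nth in_set_conv_nth dual_homogeneous_def)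
  then show ?case using alternating_form_wedge[of zs] wedge(1) list_all2_lengthD[OF wedge(4)] by simp
qed

text \<open>A factor of degree 2 produces a zero row in the determinant.\<close>

lemma wedge_drop_quadratic_eq_0:
  assumes "list_all2 (\<lambda>z l. z \<in> dual_homogeneous l) zs ls" "2 \<in> set ls"
  shows "wedge zs (map drop_quadratic fs) = 0"
proof (cases "length fs = length zs")
  case True
  let ?n = "length zs"
  let ?M = "mat ?n ?n (\<lambda>(i, j). (zs ! i) (map drop_quadratic fs ! j))"
  obtain i where i: "i < ?n" "ls ! i = 2"
    using assms by (metis in_set_conv_nth list_all2_lengthD)
  then have "zs ! i \<in> dual_homogeneous 2" using assms(1) by (auto simp: list_all2_conv_all_nth)
  note z = dual_homogeneous_drop_quadratic[OF this]
  then have "?M $$ (i, j) = 0" if "j < ?n" for j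
    using i that True by (simp add: z)
  then have "Determinant.det ?M = 0"
    using laplace_expansion_row[of ?M ?n i] i by simp
  then show ?thesis by (simp add: wedge_def)
qed (simp add: wedge_def)

lemma relative_cochain_quadratic:
  assumes "\<sigma> \<in> relative_cochains m w" "q \<in> homogeneous 2"
  shows "\<sigma> (xs @ q # ys) = 0"
proof -
  have "alternating_form m \<sigma>"
    using assms by (auto simp: relative_cochains_def intro: cochains_alternating_form)
  moreover have "interior_product q \<sigma> (xs @ ys) = 0"
    using assms by (simp add: relative_cochains_def)
  ultimately show ?thesis
    by (simp add: alternating_form_front[of m \<sigma> xs] interior_product_def)
qed

text \<open>Relative cochains vanish as soon as one argument is quadratic, so multilinearity lets the
  quadratic parts of the arguments be dropped one after the other. This is how the absence of the
  factor \<open>\<SS>\<^sub>2\<close> in relative cochains is used.\<close>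

lemma relative_cochain_drop_quadratic:
  assumes \<sigma>: "\<sigma> \<in> relative_cochains m w" and "set fs \<subseteq> ham"
  shows "\<sigma> (map drop_quadratic fs) = \<sigma> fs"
proof -
  have alt: "alternating_form m \<sigma>"
    using \<sigma> by (auto simp: relative_cochains_def intro: cochains_alternating_form)
  have "\<sigma> (xs @ map drop_quadratic fs) = \<sigma> (xs @ fs)" if "set fs \<subseteq> ham" for xs
    using that
  proof (induction fs arbitrary: xs)
    case (Cons f fs)
    have ham: "drop_quadratic f \<in> ham" "component 2 f \<in> ham"
      using Cons.prems by (auto intro: drop_quadratic_in_ham homogeneous_in_ham[OF component_homogeneous])
    have "\<sigma> (xs @ map drop_quadratic (f # fs)) = \<sigma> (xs @ drop_quadratic f # fs)"
      using Cons.IH[of "xs @ [drop_quadratic f]"] Cons.prems by simp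
    also have "\<dots> = \<sigma> (xs @ drop_quadratic f # fs) + \<sigma> (xs @ component 2 f # fs)"
      by (simp add: relative_cochain_quadratic[OF \<sigma> component_homogeneous])
    also have "\<dots> = \<sigma> (xs @ f # fs)"
      using alternating_form_add[OF alt ham, of xs fs] by (simp add: drop_quadratic_add)
    finally show ?case .
  qed simp
  from this[of "[]"] show ?thesis using assms(2) by simp
qed

lemma wedge_two:
  "wedge [y, z] fs = (case fs of [f, g] \<Rightarrow> if f \<in> ham \<and> g \<in> ham then y f * z g - y g * z f else 0 | _ \<Rightarrow> 0)"
proof (cases "\<exists>f g. fs = [f, g] \<and> f \<in> ham \<and> g \<in> ham")
  case True
  then show ?thesis
    using wedge_expand_argument[of "[]" _ "[_]" "[y, z]"]
    by (auto simp: wedge_def[of "[_]"] det_single remove_nth_def)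
next
  case False
  then show ?thesis
    by (auto simp: wedge_def length_Suc_conv split: list.splits)
qed

section \<open>Relative cochains outside degree 2\<close>

lemma coboundary_0: "coboundary 0 = 0"
  by (rule ext) (simp add: coboundary_def)

lemma coboundary_two_arguments:
  assumes "f \<in> ham" "g \<in> ham"
  shows "coboundary \<sigma> [f, g] = - \<sigma> [poisson f g]"
  using assms by (simp add: coboundary_def remove_nth_def lessThan_Suc)

lemma coboundary_three_arguments:
  assumes "f \<in> ham" "g \<in> ham" "h \<in> ham"
  shows "coboundary \<sigma> [f, g, h] = - \<sigma> [poisson f g, h] + \<sigma> [poisson f h, g] - \<sigma> [poisson g h, f]"
  using assms by (simp add: coboundary_def remove_nth_def lessThan_Suc)

lemma zero_in_relative_cochains: "0 \<in> relative_cochains m w"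
  unfolding relative_cochains_def cochains_def
  by (auto simp: coboundary_0 span_zero interior_product_def fun_eq_iff)

lemma cochain_component_4:
  assumes "\<sigma> \<in> cochains 1 2" "f \<in> ham"
  shows "\<sigma> [f] = \<sigma> [component 4 f]"
  using assms(1)
proof (induction rule: cochain_induct)
  case subspace
  show ?case by (rule subspaceI) (simp_all add: scaleR_fun_def)
next
  case (wedge zs ls)
  then obtain l where ls: "ls = [l]" by (auto simp: length_Suc_conv)
  then have "l = 4" using wedge(2,3) by simp
  with ls obtain z where z: "zs = [z]" "z \<in> dual_homogeneous 4"
    using wedge by (auto simp: list_all2_Cons2)
  have "component 4 f \<in> ham" by (rule homogeneous_in_ham[OF component_homogeneous]) simp
  then show ?case
    using assms(2) z by (simp add: wedge_def det_single dual_homogeneous_of_component)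
qed

text \<open>The factors of a 2-cochain of weight 2 have degrees 3, 3 or 2, 4. In the second case both sides
  vanish.\<close>

lemma cochain_component_3:
  assumes "\<sigma> \<in> cochains 2 2" "f \<in> ham" "g \<in> ham"
  shows "\<sigma> [drop_quadratic f, drop_quadratic g] = \<sigma> [component 3 f, component 3 g]"
  using assms(1)
proof (induction rule: cochain_induct)
  case subspace
  show ?case by (rule subspaceI) (simp_all add: scaleR_fun_def)
next
  case (wedge zs ls)
  then obtain k l where ls: "ls = [k, l]" by (auto simp: length_Suc_conv numeral_2_eq_2)
  then obtain y z where yz: "zs = [y, z]" "y \<in> dual_homogeneous k" "z \<in> dual_homogeneous l"
    using wedge(4) by (auto simp: list_all2_Cons2)
  have "k = 3 \<and> l = 3 \<or> k = 2 \<and> l = 4 \<or> k = 4 \<and> l = 2"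
    using wedge(2,3) unfolding ls by (simp; presburger)
  moreover have "component 3 f \<in> ham" "component 3 g \<in> ham"
    by (auto intro: homogeneous_in_ham[OF component_homogeneous])
  ultimately show ?case
    using assms(2,3) yz
    by (auto simp: wedge_two drop_quadratic_in_ham dual_homogeneous_of_component
        dual_homogeneous_drop_quadratic)
qed

text \<open>Factors of degree at least 3 have weight at least 1 each. So with weight 2, a product of more
  than two factors must contain one of degree 2. The empty product has weight 0.\<close>

lemma relative_cochains_eq_0_other_degrees:
  assumes "m \<noteq> 1" "m \<noteq> 2" "\<sigma> \<in> relative_cochains m 2"
  shows "\<sigma> = 0"
proof (rule ext)
  fix fs
  have \<sigma>: "\<sigma> \<in> cochains m 2" using assms(3) by (simp add: relative_cochains_def)
  have "\<sigma> (map drop_quadratic fs) = 0"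
    using \<sigma>
  proof (induction rule: cochain_induct)
    case subspace
    show ?case by (rule subspaceI) (simp_all add: scaleR_fun_def)
  next
    case (wedge zs ls)
    have "2 \<in> set ls"
    proof (rule ccontr)
      assume "2 \<notin> set ls"
      then have 3: "\<forall>l\<in>set ls. 3 \<le> l" using wedge(2)
        by (metis One_nat_def Suc_1 le_antisym not_less_eq_eq numeral_3_eq_3)
      then have "length ls \<le> (\<Sum>l\<leftarrow>ls. l - 2)" by (induction ls) auto
      then have "m = 0" using wedge(1,3) assms(1,2) by simp
      then show False using wedge(1,3) by simp
    qed
    then show ?case using wedge_drop_quadratic_eq_0 wedge(4) by blast
  qed
  then show "\<sigma> fs = 0 fs"
    using relative_cochain_drop_quadratic[OF assms(3), of fs]
      alternating_form_zero[OF cochains_alternating_form[OF \<sigma>], of fs]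
    by (cases "set fs \<subseteq> ham") auto
qed

text \<open>A relative 1-cochain is a functional on quartics, and vanishing of the interior product of its
  coboundary with quadratic polynomials says that it is invariant.\<close>

lemma relative_cochains_1_eq_0:
  assumes "\<sigma> \<in> relative_cochains 1 2"
  shows "\<sigma> = 0"
proof -
  have \<sigma>: "\<sigma> \<in> cochains 1 2" using assms by (simp add: relative_cochains_def)
  note alt = cochains_alternating_form[OF \<sigma>]
  have ham: "component 4 f \<in> ham" for f by (rule homogeneous_in_ham[OF component_homogeneous]) simp
  let ?z = "\<lambda>f. \<sigma> [component 4 f]"
  have z: "linear ?z"
    using alternating_form_add[OF alt ham ham, of "[]" _ _ "[]"] alternating_form_scaleR[OF alt ham, of "[]" _ _ "[]"]
    by (intro linearI) (simp_all add: linear_add[OF linear_component] linear_scale[OF linear_component])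
  have "?z (poisson q p) = 0" if q: "q \<in> homogeneous 2" and p: "p \<in> homogeneous (Suc 3)" for q p
  proof -
    have h: "q \<in> ham" "p \<in> ham" using q p by (auto intro: homogeneous_in_ham)
    have "interior_product q (coboundary \<sigma>) [p] = 0"
      using assms q by (simp add: relative_cochains_def)
    then show ?thesis
      using coboundary_two_arguments[OF h, of \<sigma>] cochain_component_4[OF \<sigma> poisson_in_ham[OF h]]
      by (simp add: interior_product_def)
  qed
  then have z0: "?z p = 0" if "p \<in> homogeneous (Suc 3)" for p
    using invariant_functional_eq_0[OF z that] by blast
  have "\<sigma> [f] = 0" if "f \<in> ham" for f
  proof -
    have "\<sigma> [f] = ?z (component 4 f)"
      using cochain_component_4[OF \<sigma> that] component_homogeneous[of 4 f]
      by (simp add: component_of_homogeneous)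
    also have "\<dots> = 0" by (rule z0) (use component_homogeneous[of 4 f] in simp)
    finally show ?thesis .
  qed
  then have "\<sigma> fs = 0" for fs
    using alternating_form_zero[OF alt, of fs] by (cases "length fs = 1 \<and> set fs \<subseteq> ham") (auto simp: length_Suc_conv)
  then show ?thesis by (simp add: fun_eq_iff)
qed

lemma relative_cochains_eq: "m \<noteq> 2 \<Longrightarrow> relative_cochains m 2 = {0}"
  using relative_cochains_eq_0_other_degrees[of m] relative_cochains_1_eq_0
    zero_in_relative_cochains[of m 2] by (cases "m = 1") auto

section \<open>The transvectant as a relative cocycle\<close>

definition antisymmetrization :: "(poly4 \<Rightarrow> poly4 \<Rightarrow> real) \<Rightarrow> cochain" where
  "antisymmetrization b fs =
    (case fs of [f, g] \<Rightarrow> if f \<in> ham \<and> g \<in> ham then b f g - b g f else 0 | _ \<Rightarrow> 0)"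

lemma antisymmetrization_add:
  "antisymmetrization (\<lambda>f g. b f g + b' f g) = antisymmetrization b + antisymmetrization b'"
  by (auto simp: antisymmetrization_def fun_eq_iff split: list.splits)

lemma antisymmetrization_diff:
  "antisymmetrization (\<lambda>f g. b f g - b' f g) = antisymmetrization b - antisymmetrization b'"
  by (auto simp: antisymmetrization_def fun_eq_iff split: list.splits)

lemma antisymmetrization_product: "antisymmetrization (\<lambda>f g. y f * z g) = wedge [y, z]"
  by (auto simp: antisymmetrization_def wedge_two fun_eq_iff split: list.splits)

lemma dual_homogeneous_partial:
  assumes "z \<in> dual_homogeneous n"
  shows "(\<lambda>p. z (partial i p)) \<in> dual_homogeneous (Suc n)"
proof -
  have z: "linear z" using assms by (simp add: dual_homogeneous_def)
  have "z (partial i p) = 0" if k: "k \<noteq> Suc n" "p \<in> homogeneous k" for k p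
  proof (cases k)
    case 0
    then show ?thesis using k partial_homogeneous_0 linear_0[OF z] by simp
  next
    case (Suc l)
    then show ?thesis using k partial_homogeneous[of p l i] assms by (auto simp: dual_homogeneous_def)
  qed
  then show ?thesis
    using linear_compose[OF linear_partial z, of i] by (auto simp: dual_homogeneous_def o_def)
qed

text \<open>Unfolding the recursion of the transvectant yields a sum of products \<open>y f * z g\<close>, where \<open>y\<close> and
  \<open>z\<close> are iterated derivatives at the origin. The operators \<open>P\<close> and \<open>Q\<close> accumulate the derivatives
  taken so far.\<close>

lemma transvectant_in_span_wedge:
  assumes "\<And>z. z \<in> dual_homogeneous n \<Longrightarrow> (\<lambda>p. z (P p)) \<in> dual_homogeneous m"
    and "\<And>z. z \<in> dual_homogeneous n \<Longrightarrow> (\<lambda>p. z (Q p)) \<in> dual_homogeneous m"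
  shows "antisymmetrization (\<lambda>f g. transvectant n (P f) (Q g)) \<in>
    span {wedge [y, z] | y z. y \<in> dual_homogeneous m \<and> z \<in> dual_homogeneous m}"
  using assms
proof (induction n arbitrary: P Q)
  case 0
  have "linear (\<lambda>p :: poly4. Poly_Mapping.lookup p 0)"
    by (rule linearI) (simp_all add: lookup_add)
  then have "(\<lambda>p. Poly_Mapping.lookup p 0) \<in> dual_homogeneous 0"
    by (auto simp: dual_homogeneous_def homogeneous_iff total_degree_def)
  then show ?case
    using 0 by (auto simp: antisymmetrization_product intro!: span_base)
next
  case (Suc n)
  have "antisymmetrization (\<lambda>f g. transvectant n (partial i (P f)) (partial j (Q g))) \<in>
      span {wedge [y, z] | y z. y \<in> dual_homogeneous m \<and> z \<in> dual_homogeneous m}" for i j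
    by (rule Suc.IH; rule Suc.prems[OF dual_homogeneous_partial])
  then show ?case
    by (simp only: transvectant.simps antisymmetrization_add antisymmetrization_diff)
      (intro span_add span_diff)
qed

text \<open>The third transvectant is already antisymmetric, so that antisymmetrizing doubles it. In this
  form it is visibly a sum of wedge products.\<close>

definition transvectant_form :: cochain where
  "transvectant_form = antisymmetrization (transvectant 3)"

lemma transvectant_form_eq:
  "f \<in> ham \<Longrightarrow> g \<in> ham \<Longrightarrow> transvectant_form [f, g] = 2 * transvectant 3 f g"
  using transvectant_commute[of 3 g f] by (simp add: transvectant_form_def antisymmetrization_def)

lemma transvectant_form_eq_0:
  "\<not> (length fs = 2 \<and> set fs \<subseteq> ham) \<Longrightarrow> transvectant_form fs = 0"
  by (auto simp: transvectant_form_def antisymmetrization_def split: list.splits)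

lemma transvectant_form_in_cochains: "transvectant_form \<in> cochains 2 2"
proof -
  let ?k = "\<lambda>l::nat. if l = 3 then 2 else (0::nat)"
  have "transvectant_form \<in> span {wedge [y, z] | y z. y \<in> dual_homogeneous 3 \<and> z \<in> dual_homogeneous 3}"
    unfolding transvectant_form_def using transvectant_in_span_wedge[of 3 "\<lambda>p. p" 3 "\<lambda>p. p"] by simp
  also have "\<dots> \<subseteq> wedge_summand ?k"
    unfolding wedge_summand_def
  proof (rule span_mono, safe)
    fix y z assume "y \<in> dual_homogeneous 3" "z \<in> dual_homogeneous 3"
    then show "\<exists>zs ls. wedge [y, z] = wedge zs \<and> sorted ls \<and> (\<forall>l. count_list ls l = ?k l) \<and>
        list_all2 (\<lambda>z l. z \<in> dual_homogeneous l) zs ls"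
      by (intro exI[of _ "[y, z]"] exI[of _ "[3, 3]"]) simp
  qed
  also have "\<dots> \<subseteq> cochains 2 2"
    unfolding cochains_def by (rule subset_trans[OF _ span_superset]) (rule UN_upper, simp)
  finally show ?thesis .
qed

text \<open>By invariance the cyclic sum vanishes when an argument is quadratic, so only arguments of order
  at least 3 matter. Their brackets have order at least 4, which the third transvectant does not
  see.\<close>

lemma transvectant_cocycle:
  assumes "f \<in> ham" "g \<in> ham" "h \<in> ham"
  shows "transvectant 3 (poisson f g) h + transvectant 3 (poisson g h) f + transvectant 3 (poisson h f) g = 0"
proof -
  define J where "J f g h = transvectant 3 (poisson f g) h + transvectant 3 (poisson g h) f
    + transvectant 3 (poisson h f) g" for f g h
  have cyc: "J f g h = J g h f" for f g h by (simp add: J_def)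
  have quad: "J q g h = 0" if "q \<in> homogeneous 2" for q g h
  proof -
    have "transvectant 3 g (poisson q h) = - transvectant 3 (poisson q h) g"
      using transvectant_commute[of 3 g "poisson q h"] by simp
    moreover have "transvectant 3 (poisson h q) g = - transvectant 3 (poisson q h) g"
      by (subst poisson_anticommute) (simp add: transvectant_neg_left)
    ultimately show ?thesis
      using transvectant_invariant[OF that, of 3 g h] transvectant_quadratic[OF that]
      by (simp add: J_def)
  qed
  have add: "J (f + f') g h = J f g h + J f' g h" for f f' g h
    by (simp add: J_def bilinear_ladd[OF bilinear_poisson] bilinear_radd[OF bilinear_poisson]
        transvectant_add_left transvectant_add_right)
  have drop: "J f g h = J (drop_quadratic f) g h" for f g h
    using add[of "drop_quadratic f" "component 2 f" g h] quad[OF component_homogeneous, of f g h]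
    by (simp add: drop_quadratic_add)
  have "J f g h = J (drop_quadratic f) (drop_quadratic g) (drop_quadratic h)"
    by (metis drop cyc)
  also have "\<dots> = 0"
    unfolding J_def
    using assms by (simp add: transvectant_eq_0 poisson_order drop_quadratic_order)
  finally show ?thesis by (simp add: J_def)
qed

lemma coboundary_transvectant_form: "coboundary transvectant_form = 0"
proof (rule ext)
  fix fs
  consider "\<not> set fs \<subseteq> ham" | "length fs \<noteq> 3" | "length fs = 3" "set fs \<subseteq> ham" by blast
  then show "coboundary transvectant_form fs = 0 fs"
  proof cases
    case 2
    then have "transvectant_form (poisson (fs ! i) (fs ! j) # remove_nth i (remove_nth j fs)) = 0"
      if "j < length fs" "i < j" for i j
      using that by (intro transvectant_form_eq_0) (auto simp: length_remove_nth)
    then show ?thesis by (simp add: coboundary_def)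
  next
    case 3
    then obtain f g h where fs: "fs = [f, g, h]" "f \<in> ham" "g \<in> ham" "h \<in> ham"
      by (auto simp: length_Suc_conv numeral_3_eq_3)
    have "transvectant 3 (poisson h f) g = - transvectant 3 (poisson f h) g"
      by (subst poisson_anticommute) (simp add: transvectant_neg_left)
    then show ?thesis
      using transvectant_cocycle[OF fs(2-4)]
      by (simp add: fs coboundary_three_arguments transvectant_form_eq poisson_in_ham)
  qed (simp add: coboundary_def)
qed

lemma transvectant_form_relative_cocycle: "transvectant_form \<in> relative_cocycles 2 2"
proof -
  have "interior_product q transvectant_form = 0" if q: "q \<in> homogeneous 2" for q
  proof (rule ext)
    fix fs
    have "q \<in> ham" using q by (rule homogeneous_in_ham) simp
    then show "interior_product q transvectant_form fs = 0 fs"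
      by (cases "length (q # fs) = 2 \<and> set (q # fs) \<subseteq> ham")
        (auto simp: interior_product_def length_Suc_conv transvectant_form_eq transvectant_form_eq_0
          transvectant_quadratic[OF q])
  qed
  then show ?thesis
    by (auto simp: relative_cocycles_def relative_cochains_def transvectant_form_in_cochains
        coboundary_transvectant_form interior_product_def fun_eq_iff)
qed

lemma transvectant_form_nonzero: "transvectant_form \<noteq> 0"
proof
  assume "transvectant_form = 0"
  moreover have "Var i * (Var j * Var k) \<in> ham" for i j k
    using Var_times_homogeneous(2) by (rule homogeneous_in_ham) simp
  ultimately show False
    using transvectant_form_eq transvectant_highest by (metis zero_fun_apply mult_eq_0_iff zero_neq_numeral)
qed

lemma transvectant_component_3: "transvectant 3 (component 3 f) (component 3 g) = transvectant 3 f g"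
proof -
  have l: "transvectant 3 (component 3 f) g = transvectant 3 f g" for f g
  proof -
    have "transvectant 3 (f - component 3 f) g = 0"
      by (rule transvectant_eq_0) (simp add: lookup_minus lookup_component)
    then show ?thesis by (simp add: transvectant_diff_left)
  qed
  then show ?thesis
    using transvectant_commute[of 3 f "component 3 g"] transvectant_commute[of 3 f g] by simp
qed

section \<open>Relative cochains of degree 2 and the Betti numbers\<close>

text \<open>A relative 2-cochain is an invariant form on cubics. Subtracting the multiple of the transvectant
  with the same value on the pair \<open>x\<^sub>1\<^sup>3, x\<^sub>4\<^sup>3\<close> leaves an invariant form which is zero by uniqueness.\<close>

lemma relative_cochain_2_eq_multiple:
  assumes "\<sigma> \<in> relative_cochains 2 2"
  shows "\<exists>c. \<sigma> = c *\<^sub>R transvectant_form"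
proof -
  have \<sigma>: "\<sigma> \<in> cochains 2 2" using assms by (simp add: relative_cochains_def)
  note alt = cochains_alternating_form[OF \<sigma>]
  have ham: "component 3 f \<in> ham" for f by (rule homogeneous_in_ham[OF component_homogeneous]) simp
  define B where "B f g = \<sigma> [component 3 f, component 3 g]" for f g
  have \<sigma>B: "\<sigma> [f, g] = B f g" if "f \<in> ham" "g \<in> ham" for f g
    using relative_cochain_drop_quadratic[OF assms, of "[f, g]"] cochain_component_3[OF \<sigma> that] that
    by (simp add: B_def)
  have bilB: "bilinear B"
    using alternating_form_add[OF alt ham ham, of "[]"] alternating_form_add[OF alt ham ham, of "[_]" _ _ "[]"]
      alternating_form_scaleR[OF alt ham, of "[]"] alternating_form_scaleR[OF alt ham, of "[_]" _ _ "[]"]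
    unfolding bilinear_def
    by (auto intro!: linearI simp: B_def linear_add[OF linear_component] linear_scale[OF linear_component])
  have inv: "B (poisson q f) g + B f (poisson q g) = 0"
    if q: "q \<in> homogeneous 2" and f: "f \<in> homogeneous 3" and g: "g \<in> homogeneous 3" for q f g
  proof -
    have h: "q \<in> ham" "f \<in> ham" "g \<in> ham" using q f g by (auto intro: homogeneous_in_ham)
    have "interior_product q (coboundary \<sigma>) [f, g] = 0"
      using assms q by (simp add: relative_cochains_def)
    then have "- \<sigma> [poisson q f, g] + \<sigma> [poisson q g, f] - \<sigma> [poisson f g, q] = 0"
      using coboundary_three_arguments[OF h, of \<sigma>] by (simp add: interior_product_def)
    moreover have "\<sigma> [poisson f g, q] = 0"
      using relative_cochain_quadratic[OF assms q, of "[poisson f g]" "[]"] by simp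
    moreover have "\<sigma> [f, poisson q g] = - \<sigma> [poisson q g, f]"
      using alternating_form_front[OF alt, of "[f]" "poisson q g" "[]"] by simp
    ultimately show ?thesis using h by (simp add: \<sigma>B[symmetric] poisson_in_ham)
  qed
  let ?x = "Var 1 * (Var 1 * Var 1)" and ?y = "Var 4 * (Var 4 * Var 4)"
  define c where "c = B ?x ?y / transvectant 3 ?x ?y"
  let ?D = "\<lambda>f g. B f g - c * transvectant 3 f g"
  have D: "?D f g = 0" if "f \<in> homogeneous 3" "g \<in> homogeneous 3" for f g
  proof (rule invariant_form_eq_0[of ?D])
    show "bilinear ?D"
      using bilB bilinear_transvectant[of 3]
      by (auto simp: bilinear_def linear_iff algebra_simps)
    show "?D (poisson q f) g + ?D f (poisson q g) = 0"
      if "q \<in> homogeneous 2" "f \<in> homogeneous 3" "g \<in> homogeneous 3" for q f g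
    proof -
      have "?D (poisson q f) g + ?D f (poisson q g) = (B (poisson q f) g + B f (poisson q g))
          - c * (transvectant 3 (poisson q f) g + transvectant 3 f (poisson q g))"
        by (simp add: algebra_simps)
      then show ?thesis using inv[OF that] transvectant_invariant[OF that(1), of 3 f g] by simp
    qed
    show "?D ?x ?y = 0" using transvectant_highest by (simp add: c_def)
  qed (use that in auto)
  \<comment> \<open>The factor \<open>1 / 2\<close> compensates the doubling in the antisymmetrization.\<close>
  have "\<sigma> fs = ((c / 2) *\<^sub>R transvectant_form) fs" for fs
  proof (cases "length fs = 2 \<and> set fs \<subseteq> ham")
    case True
    then obtain f g where fs: "fs = [f, g]" "f \<in> ham" "g \<in> ham"
      by (auto simp: length_Suc_conv numeral_2_eq_2)
    have "\<sigma> [f, g] = B (component 3 f) (component 3 g)"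
      using fs by (simp add: \<sigma>B) (simp add: B_def component_of_homogeneous[OF component_homogeneous])
    also have "\<dots> = c * transvectant 3 f g"
      using D[OF component_homogeneous component_homogeneous, of f g] by (simp add: transvectant_component_3)
    finally show ?thesis using fs by (simp add: scaleR_fun_def transvectant_form_eq)
  next
    case False
    then show ?thesis
      by (simp add: alternating_form_zero[OF alt] scaleR_fun_def transvectant_form_eq_0)
  qed
  then show ?thesis by blast
qed

theorem mainTheorem3:
  fixes m :: nat
  shows "has_betti_number m 2 (if m = 2 then 1 else 0)"
proof (cases "m = 2")
  case False
  have "relative_cocycles m 2 \<subseteq> {0}"
    using relative_cochains_eq[OF False] by (auto simp: relative_cocycles_def)
  then have "has_quotient_dim (relative_cocycles m 2) (relative_coboundaries m 2) 0"
    unfolding has_quotient_dim_def by (intro exI[of _ "{}"]) fastforce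
  then show ?thesis
    using False by (simp add: has_betti_number_def)
next
  case True
  have B: "relative_coboundaries 2 2 = {0}"
    by (simp add: relative_coboundaries_def relative_cochains_eq coboundary_0)
  have coset: "coset {0} x = {x}" for x :: cochain by (simp add: coset_def)
  have "has_quotient_dim (relative_cocycles 2 2) {0} 1"
    unfolding has_quotient_dim_def coset
  proof (intro exI[of _ "{transvectant_form}"] conjI allI impI ballI)
    fix z assume "z \<in> relative_cocycles 2 2"
    then obtain c where "z = c *\<^sub>R transvectant_form"
      using relative_cochain_2_eq_multiple by (auto simp: relative_cocycles_def)
    then show "\<exists>c. {z} = {\<Sum>x\<in>{transvectant_form}. c x *\<^sub>R x}"
      by (intro exI[of _ "\<lambda>_. c"]) simp
  qed (use transvectant_form_relative_cocycle transvectant_form_nonzero in auto)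
  then show ?thesis using True by (simp add: has_betti_number_def B)
qed

end
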